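(* Let $\mathcal{H}$ be a proper minor-closed class of graphs. Then the Acyclic Matching problem and the Induced Matching problem restricted to input graphs in $\mathcal{H}$ are both fixed-parameter tractable with respect to the parameter $k$.
   Context: All graphs are finite and simple. A class of graphs is minor-closed if it is closed under taking minors, and proper if it does not contain all graphs. A matching $M$ (set of pairwise nonadjacent edges) is acyclic if the subgraph of $G$ induced on the endpoints of the edges of $M$ is acyclic, and induced if that induced subgraph has exactly $|M|$ edges. Acyclic (resp. Induced) Matching problem: given a graph $G$ and a positive integer $k$, decide whether $G$ has an acyclic (resp. induced) matching of size $k$. *)

theory Defs
  imports Complex_Main "HOL-Library.Log_Nat"
begin

section \<open>Finite simple graphs\<close>

record 'a sgraph =
  verts :: "'a set"
  edges :: "'a set set"

definition simple_graph :: "'a sgraph \<Rightarrow> bool" where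
  "simple_graph G \<longleftrightarrow> finite (verts G) \<and>
     (\<forall>e\<in>edges G. \<exists>u v. u \<in> verts G \<and> v \<in> verts G \<and> u \<noteq> v \<and> e = {u, v})"

definition isomorphic :: "'a sgraph \<Rightarrow> 'b sgraph \<Rightarrow> bool" where
  "isomorphic G H \<longleftrightarrow>
     (\<exists>\<phi>. bij_betw \<phi> (verts G) (verts H) \<and> edges H = (\<lambda>e. \<phi> ` e) ` edges G)"

definition induced_subgraph :: "'a sgraph \<Rightarrow> 'a set \<Rightarrow> 'a sgraph" where
  "induced_subgraph G S = \<lparr>verts = verts G \<inter> S, edges = {e \<in> edges G. e \<subseteq> S}\<rparr>"

definition is_cycle :: "'a sgraph \<Rightarrow> 'a list \<Rightarrow> bool" where
  "is_cycle G p \<longleftrightarrow> length p \<ge> 3 \<and> distinct p \<and> set p \<subseteq> verts G \<and>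
     (\<forall>i. Suc i < length p \<longrightarrow> {p ! i, p ! Suc i} \<in> edges G) \<and>
     {last p, hd p} \<in> edges G"

definition acyclic_graph :: "'a sgraph \<Rightarrow> bool" where
  "acyclic_graph G \<longleftrightarrow> (\<nexists>p. is_cycle G p)"


section \<open>Minors\<close>

definition delete_vertex :: "'a sgraph \<Rightarrow> 'a \<Rightarrow> 'a sgraph" where
  "delete_vertex G v = \<lparr>verts = verts G - {v}, edges = {e \<in> edges G. v \<notin> e}\<rparr>"

definition delete_edge :: "'a sgraph \<Rightarrow> 'a set \<Rightarrow> 'a sgraph" where
  "delete_edge G e = \<lparr>verts = verts G, edges = edges G - {e}\<rparr>"

text \<open>The vertex resulting from the contraction of the edge \<open>{u, v}\<close> is again called \<open>u\<close>.
  Parallel edges merge because edges form a set; the loop \<open>{u}\<close> is removed.\<close>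

definition contract_edge :: "'a sgraph \<Rightarrow> 'a \<Rightarrow> 'a \<Rightarrow> 'a sgraph" where
  "contract_edge G u v =
     \<lparr>verts = verts G - {v},
      edges = (\<lambda>e. (\<lambda>x. if x = v then u else x) ` e) ` edges G - {{u}}\<rparr>"

inductive has_minor :: "'a sgraph \<Rightarrow> 'a sgraph \<Rightarrow> bool" for G :: "'a sgraph" where
  refl: "has_minor G G"
| iso: "has_minor G H \<Longrightarrow> isomorphic H H' \<Longrightarrow> has_minor G H'"
| delete_vertex: "has_minor G H \<Longrightarrow> v \<in> verts H \<Longrightarrow> has_minor G (delete_vertex H v)"
| delete_edge: "has_minor G H \<Longrightarrow> e \<in> edges H \<Longrightarrow> has_minor G (delete_edge H e)"
| contract_edge: "has_minor G H \<Longrightarrow> {u, v} \<in> edges H \<Longrightarrow> u \<noteq> v \<Longrightarrow>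
    has_minor G (contract_edge H u v)"

text \<open>Every finite graph has an isomorphic copy with vertices in \<^typ>\<open>nat\<close>, so classes of graphs
  are sets of graphs on natural numbers. Minor-closed classes are closed under isomorphism, since
  isomorphic copies are minors.\<close>

definition graph_class :: "nat sgraph set \<Rightarrow> bool" where
  "graph_class \<H> \<longleftrightarrow> (\<forall>G\<in>\<H>. simple_graph G)"

definition minor_closed :: "nat sgraph set \<Rightarrow> bool" where
  "minor_closed \<H> \<longleftrightarrow> (\<forall>G\<in>\<H>. \<forall>G'. has_minor G G' \<longrightarrow> G' \<in> \<H>)"

definition proper_class :: "nat sgraph set \<Rightarrow> bool" where
  "proper_class \<H> \<longleftrightarrow> (\<exists>G. simple_graph G \<and> G \<notin> \<H>)"


section \<open>Matchings\<close>

definition matching :: "'a sgraph \<Rightarrow> 'a set set \<Rightarrow> bool" where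
  "matching G M \<longleftrightarrow> M \<subseteq> edges G \<and> (\<forall>e\<in>M. \<forall>e'\<in>M. e \<noteq> e' \<longrightarrow> e \<inter> e' = {})"

definition acyclic_matching :: "'a sgraph \<Rightarrow> 'a set set \<Rightarrow> bool" where
  "acyclic_matching G M \<longleftrightarrow> matching G M \<and> acyclic_graph (induced_subgraph G (\<Union>M))"

definition induced_matching :: "'a sgraph \<Rightarrow> 'a set set \<Rightarrow> bool" where
  "induced_matching G M \<longleftrightarrow> matching G M \<and>
     card (edges (induced_subgraph G (\<Union>M))) = card M"


section \<open>Random access machines\<close>

text \<open>The uniform-cost random access machine with addition, truncated subtraction and halving, the
  usual machine model of parameterized complexity theory. Without multiplication, \<open>t\<close> steps
  increase the bit length of the largest number by at most \<open>t\<close> plus a constant, so the model is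
  polynomially equivalent to Turing machines.
  The input is a read-only list of numbers; all registers are initially 0.\<close>

datatype instr =
    Const nat nat    \<comment> \<open>\<open>R i := c\<close>\<close>
  | Add nat nat nat  \<comment> \<open>\<open>R i := R j + R l\<close>\<close>
  | Sub nat nat nat  \<comment> \<open>\<open>R i := R j - R l\<close>\<close>
  | Half nat nat     \<comment> \<open>\<open>R i := R j div 2\<close>\<close>
  | Load nat nat     \<comment> \<open>\<open>R i := R (R j)\<close>\<close>
  | Store nat nat    \<comment> \<open>\<open>R (R i) := R j\<close>\<close>
  | Read nat nat     \<comment> \<open>\<open>R i :=\<close> input number at position \<open>R j\<close>, 0 beyond the end of the input\<close>
  | Jump nat         \<comment> \<open>\<open>goto a\<close>\<close>
  | JumpZero nat nat \<comment> \<open>\<open>if R i = 0 then goto a\<close>\<close>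

type_synonym config = "nat \<times> (nat \<Rightarrow> nat)"

fun exec :: "nat list \<Rightarrow> instr \<Rightarrow> config \<Rightarrow> config" where
  "exec x (Const i c) (pc, R) = (Suc pc, R(i := c))"
| "exec x (Add i j l) (pc, R) = (Suc pc, R(i := R j + R l))"
| "exec x (Sub i j l) (pc, R) = (Suc pc, R(i := R j - R l))"
| "exec x (Half i j) (pc, R) = (Suc pc, R(i := R j div 2))"
| "exec x (Load i j) (pc, R) = (Suc pc, R(i := R (R j)))"
| "exec x (Store i j) (pc, R) = (Suc pc, R(R i := R j))"
| "exec x (Read i j) (pc, R) = (Suc pc, R(i := (if R j < length x then x ! R j else 0)))"
| "exec x (Jump a) (pc, R) = (a, R)"
| "exec x (JumpZero i a) (pc, R) = (if R i = 0 then a else Suc pc, R)"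

text \<open>The machine has halted when the program counter is outside the program.\<close>

definition step :: "instr list \<Rightarrow> nat list \<Rightarrow> config \<Rightarrow> config" where
  "step P x cf = (if fst cf < length P then exec x (P ! fst cf) cf else cf)"

definition outputs_within :: "instr list \<Rightarrow> nat list \<Rightarrow> nat \<Rightarrow> nat \<Rightarrow> bool" where
  "outputs_within P x y t \<longleftrightarrow>
     (\<exists>pc R. (step P x ^^ t) (0, \<lambda>_. 0) = (pc, R) \<and> length P \<le> pc \<and> R 0 = y)"

definition computable :: "(nat \<Rightarrow> nat) \<Rightarrow> bool" where
  "computable f \<longleftrightarrow> (\<exists>P. \<forall>n. \<exists>t. outputs_within P [n] (f n) t)"


section \<open>Fixed-parameter tractability\<close>

text \<open>Length in bits, with one separating symbol per number.\<close>

definition input_size :: "nat list \<Rightarrow> nat" where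
  "input_size x = (\<Sum>a\<leftarrow>x. Suc (floorlog 2 a))"

text \<open>\<open>I\<close> is the set of admissible instances, \<open>enc\<close> their encoding, \<open>\<kappa>\<close> the parameter and
  \<open>yes\<close> the question. Nothing is required of the machine outside \<open>I\<close>.\<close>

definition fixed_parameter_tractable ::
    "'i set \<Rightarrow> ('i \<Rightarrow> nat list) \<Rightarrow> ('i \<Rightarrow> nat) \<Rightarrow> ('i \<Rightarrow> bool) \<Rightarrow> bool" where
  "fixed_parameter_tractable I enc \<kappa> yes \<longleftrightarrow>
     (\<exists>P f c. computable f \<and>
        (\<forall>x\<in>I. outputs_within P (enc x) (if yes x then 1 else 0)
                  (f (\<kappa> x) * input_size (enc x) ^ c)))"


section \<open>The matching problems\<close>

type_synonym graph_instance = "nat sgraph \<times> nat"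

text \<open>As usual, input graphs have vertex set \<open>{0, \<dots>, n - 1}\<close>, and are given by \<open>n\<close> and
  their adjacency matrix, row by row.\<close>

definition instances :: "nat sgraph set \<Rightarrow> graph_instance set" where
  "instances \<H> = {(G, k). G \<in> \<H> \<and> (\<exists>n. verts G = {..<n}) \<and> k > 0}"

definition encode :: "graph_instance \<Rightarrow> nat list" where
  "encode = (\<lambda>(G, k). let n = card (verts G) in
     n # k # concat (map (\<lambda>i. map (\<lambda>j. if {i, j} \<in> edges G then 1 else 0) [0..<n]) [0..<n]))"

definition parameter :: "graph_instance \<Rightarrow> nat" where
  "parameter = (\<lambda>(G, k). k)"

definition acyclic_matching_problem :: "graph_instance \<Rightarrow> bool" where
  "acyclic_matching_problem = (\<lambda>(G, k). \<exists>M. acyclic_matching G M \<and> card M = k)"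

definition induced_matching_problem :: "graph_instance \<Rightarrow> bool" where
  "induced_matching_problem = (\<lambda>(G, k). \<exists>M. induced_matching G M \<and> card M = k)"

end

theory Submission
  imports Defs "HOL-Library.Ramsey" "HOL-Library.Disjoint_Sets"
begin

text \<open>A proper minor-closed class excludes the clique with \<open>h\<close> vertices, for some \<open>h\<close>. Contracting
  the edges of a matching gives a minor without such a clique, so by Ramsey's theorem every matching
  of size \<open>2 ^ (h + k)\<close> contains \<open>k\<close> edges that are pairwise not joined by an edge, that is, an
  induced matching, which is also an acyclic one. If there is no matching of that size, then some
  vertex cover is bounded in terms of \<open>k\<close>, and so is the number of distinct neighbourhoods.

  A graph has an acyclic (induced) matching of size \<open>k\<close> iff there are \<open>k\<close> edges, listed such that
  each has at most one (no) edge to its successors. This property only depends on the adjacencies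
  between the listed vertices, so each vertex can be replaced by the least one with the same
  neighbourhood. The machine accepts if there are too many of these representatives, and otherwise
  tries all sequences of them; the sequences are coded by the bits of a number below a triply
  exponential bound in \<open>k\<close>.\<close>

section \<open>Minor-closed classes\<close>

lemma simple_graph_edgeE:
  assumes "simple_graph G" "e \<in> edges G"
  obtains u v where "u \<in> verts G" "v \<in> verts G" "u \<noteq> v" "e = {u, v}"
  using assms unfolding simple_graph_def by blast

lemma simple_graph_edgeD:
  assumes "simple_graph G" "{u, v} \<in> edges G"
  shows "u \<noteq> v" "u \<in> verts G" "v \<in> verts G"
  using assms by (auto elim!: simple_graph_edgeE simp: doubleton_eq_iff)

lemma edges_subset_nsets: "simple_graph G \<Longrightarrow> edges G \<subseteq> [verts G]\<^bsup>2\<^esup>"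
  by (auto elim: simple_graph_edgeE)

lemma finite_edges: "simple_graph G \<Longrightarrow> finite (edges G)"
  by (meson edges_subset_nsets finite_imp_finite_nsets finite_subset simple_graph_def)

lemma simple_graph_induced_subgraph: "simple_graph G \<Longrightarrow> simple_graph (induced_subgraph G S)"
  unfolding simple_graph_def induced_subgraph_def by fastforce

lemma simple_graph_delete_vertex: "simple_graph G \<Longrightarrow> simple_graph (delete_vertex G v)"
  unfolding simple_graph_def delete_vertex_def by fastforce

definition complete_graph :: "'a set \<Rightarrow> 'a sgraph" where
  "complete_graph V = \<lparr>verts = V, edges = [V]\<^bsup>2\<^esup>\<rparr>"

lemma isomorphic_complete_graph:
  assumes "bij_betw \<phi> V W"
  shows "isomorphic (complete_graph V) (complete_graph W)"
  using assms bij_betw_imp_surj_on[OF bij_betw_nsets[OF assms, of 2]]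
  by (auto simp: isomorphic_def complete_graph_def)

lemma minor_closed_delete_edges:
  assumes "minor_closed \<H>" "G \<in> \<H>" "finite D" "D \<subseteq> edges G"
  shows "G\<lparr>edges := edges G - D\<rparr> \<in> \<H>"
  using assms(3,4)
proof (induction D rule: finite_induct)
  case empty
  show ?case using assms(2) by simp
next
  case (insert e D)
  let ?H = "G\<lparr>edges := edges G - D\<rparr>"
  have "delete_edge ?H e = G\<lparr>edges := edges G - insert e D\<rparr>"
    by (cases G) (auto simp: delete_edge_def)
  moreover have "has_minor ?H (delete_edge ?H e)"
    using insert by (intro has_minor.delete_edge has_minor.refl) auto
  ultimately show ?case using insert assms(1) by (auto simp: minor_closed_def)
qed

lemma minor_closed_induced_subgraph:
  assumes "minor_closed \<H>" "G \<in> \<H>" "simple_graph G"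
  shows "induced_subgraph G S \<in> \<H>"
proof -
  have delete: "induced_subgraph G (- D) \<in> \<H>" if "finite D" "D \<subseteq> verts G" for D
    using that
  proof (induction D rule: finite_induct)
    case empty
    have "induced_subgraph G (- {}) = G" by (simp add: induced_subgraph_def)
    then show ?case using assms(2) by simp
  next
    case (insert v D)
    let ?H = "induced_subgraph G (- D)"
    have "delete_vertex ?H v = induced_subgraph G (- insert v D)"
      by (auto simp: delete_vertex_def induced_subgraph_def)
    moreover have "has_minor ?H (delete_vertex ?H v)"
      using insert
      by (intro has_minor.delete_vertex has_minor.refl) (auto simp: induced_subgraph_def)
    ultimately show ?case using insert assms(1) by (auto simp: minor_closed_def)
  qed
  have "induced_subgraph G S = induced_subgraph G (- (verts G - S))"
    using edges_subset_nsets[OF assms(3)] by (auto simp: induced_subgraph_def nsets_def)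
  then show ?thesis using delete[of "verts G - S"] assms(3) by (simp add: simple_graph_def)
qed

definition excludes_clique :: "nat sgraph set \<Rightarrow> nat \<Rightarrow> bool" where
  "excludes_clique \<H> h \<longleftrightarrow> (\<forall>V. finite V \<and> card V = h \<longrightarrow> complete_graph V \<notin> \<H>)"

lemma proper_minor_closed_excludes_clique:
  assumes "minor_closed \<H>" "proper_class \<H>"
  obtains h where "excludes_clique \<H> h"
proof -
  obtain X where X: "simple_graph X" "X \<notin> \<H>" using assms(2) by (auto simp: proper_class_def)
  have finX: "finite (verts X)" using X(1) by (simp add: simple_graph_def)
  have "complete_graph V \<notin> \<H>" if V: "finite V" "card V = card (verts X)" for V
  proof
    assume "complete_graph V \<in> \<H>"
    moreover obtain \<phi> where "bij_betw \<phi> V (verts X)"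
      using finite_same_card_bij[OF V(1) finX V(2)] by blast
    ultimately have complete: "complete_graph (verts X) \<in> \<H>"
      using assms(1) has_minor.iso[OF has_minor.refl isomorphic_complete_graph]
      unfolding minor_closed_def by blast
    have "finite (edges (complete_graph (verts X)))"
      using finX by (simp add: complete_graph_def finite_imp_finite_nsets)
    moreover have "edges X \<subseteq> [verts X]\<^bsup>2\<^esup>" by (rule edges_subset_nsets[OF X(1)])
    ultimately have "(complete_graph (verts X))\<lparr>edges := edges X\<rparr> \<in> \<H>"
      using minor_closed_delete_edges[OF assms(1) complete, of "[verts X]\<^bsup>2\<^esup> - edges X"]
      by (simp add: complete_graph_def double_diff)
    then show False using X(2) by (cases X) (simp add: complete_graph_def)
  qed
  then show thesis using that[of "card (verts X)"] by (simp add: excludes_clique_def)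
qed

definition joined :: "'a sgraph \<Rightarrow> 'a set \<Rightarrow> 'a set \<Rightarrow> bool" where
  "joined G A B \<longleftrightarrow> (\<exists>x\<in>A. \<exists>y\<in>B. {x, y} \<in> edges G)"

lemma joined_commute: "joined G A B \<longleftrightarrow> joined G B A"
  unfolding joined_def by (metis insert_commute)

definition merge :: "'a \<Rightarrow> 'a \<Rightarrow> 'a \<Rightarrow> 'a" where
  "merge u v x = (if x = v then u else x)"

lemma contract_edge_simps [simp]:
  "verts (contract_edge G u v) = verts G - {v}"
  "edges (contract_edge G u v) = (`) (merge u v) ` edges G - {{u}}"
  by (simp_all add: contract_edge_def merge_def[abs_def])

lemma joined_contract_edge:
  assumes "joined G A B" "merge u v ` A \<inter> merge u v ` B = {}"
  shows "joined (contract_edge G u v) (merge u v ` A) (merge u v ` B)"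
proof -
  obtain x y where xy: "x \<in> A" "y \<in> B" "{x, y} \<in> edges G"
    using assms(1) by (auto simp: joined_def)
  have "merge u v x \<noteq> merge u v y" using xy(1,2) assms(2) by auto
  moreover have "merge u v ` {x, y} \<in> (`) (merge u v) ` edges G" using xy(3) by (rule imageI)
  ultimately have "{merge u v x, merge u v y} \<in> edges (contract_edge G u v)" by auto
  then show ?thesis using xy(1,2) by (auto simp: joined_def)
qed

text \<open>A model of a complete minor whose branch sets are vertices and edges.\<close>

definition clique_model :: "'a sgraph \<Rightarrow> 'a set set \<Rightarrow> bool" where
  "clique_model G \<B> \<longleftrightarrow> disjoint \<B> \<and> pairwise (joined G) \<B> \<and>
     (\<forall>B\<in>\<B>. B \<in> edges G \<or> (\<exists>v\<in>verts G. B = {v}))"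

lemma image_merge_disjoint:
  assumes "disjoint \<B>" "{a, b} \<in> \<B>"
  shows "B \<in> \<B> \<Longrightarrow> merge a b ` B = (if B = {a, b} then {a} else B)"
    and "A \<in> \<B> \<Longrightarrow> B \<in> \<B> \<Longrightarrow> A \<noteq> B \<Longrightarrow> merge a b ` A \<inter> merge a b ` B = {}"
    and "inj_on ((`) (merge a b)) \<B>"
proof -
  have disj: "A \<inter> B = {}" if "A \<in> \<B>" "B \<in> \<B>" "A \<noteq> B" for A B
    using assms(1) that by (auto simp: pairwise_def disjnt_def)
  have off: "a \<notin> B" "b \<notin> B" if "B \<in> \<B>" "B \<noteq> {a, b}" for B
    using disj[OF that(1) assms(2) that(2)] by auto
  show image: "merge a b ` B = (if B = {a, b} then {a} else B)" if "B \<in> \<B>" for B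
    using off[OF that] by (auto simp: merge_def image_iff)
  show "merge a b ` A \<inter> merge a b ` B = {}" if "A \<in> \<B>" "B \<in> \<B>" "A \<noteq> B" for A B
    unfolding image[OF that(1)] image[OF that(2)]
    using off[OF that(1)] off[OF that(2)] disj[OF that] that(3) by auto
  show "inj_on ((`) (merge a b)) \<B>"
  proof (rule inj_onI)
    fix A B assume "A \<in> \<B>" "B \<in> \<B>" "merge a b ` A = merge a b ` B"
    then show "A = B" using image[of A] image[of B] off[of A] off[of B] by (auto split: if_splits)
  qed
qed

lemma clique_model_contract_edge:
  assumes G: "simple_graph G" and model: "clique_model G \<B>"
    and ab: "{a, b} \<in> \<B>" "{a, b} \<in> edges G"
  shows "clique_model (contract_edge G a b) ((`) (merge a b) ` \<B>)"
proof -
  let ?H = "contract_edge G a b" and ?f = "(`) (merge a b)"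
  have disjoint: "disjoint \<B>" using model by (simp add: clique_model_def)
  note merge = image_merge_disjoint[OF disjoint ab(1)]
  have "B \<in> edges ?H \<or> (\<exists>v\<in>verts ?H. B = {v})" if B: "B \<in> ?f ` \<B>" for B
  proof -
    obtain A where A: "A \<in> \<B>" "B = ?f A" using B by blast
    show ?thesis
    proof (cases "A = {a, b}")
      case True
      then show ?thesis using merge(1)[OF A(1)] A(2) simple_graph_edgeD[OF G ab(2)] by auto
    next
      case False
      then have "B = A" using merge(1)[OF A(1)] A(2) by simp
      moreover have "a \<notin> A" "b \<notin> A"
        using pairwiseD[OF disjoint A(1) ab(1) False] by (auto simp: disjnt_def)
      moreover have "A \<in> edges G \<or> (\<exists>v\<in>verts G. A = {v})"
        using model A(1) by (simp add: clique_model_def)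
      ultimately show ?thesis using A(2) by auto
    qed
  qed
  moreover have "disjoint (?f ` \<B>)"
    using merge(2) unfolding pairwise_image disjnt_def pairwise_def by blast
  moreover have "pairwise (joined ?H) (?f ` \<B>)"
    using model joined_contract_edge[OF _ merge(2)]
    unfolding pairwise_image clique_model_def by (simp add: pairwise_def)
  ultimately show ?thesis by (simp add: clique_model_def)
qed

lemma clique_model_no_edge:
  assumes G: "simple_graph G" and model: "clique_model G \<B>" and "\<B> \<inter> edges G = {}"
  shows "finite (\<Union>\<B>)" "card (\<Union>\<B>) = card \<B>" "induced_subgraph G (\<Union>\<B>) = complete_graph (\<Union>\<B>)"
proof -
  have singleton: "\<exists>v\<in>verts G. B = {v}" if "B \<in> \<B>" for B
    using model assms(3) that by (auto simp: clique_model_def)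
  have V: "\<Union>\<B> \<subseteq> verts G" using singleton by fastforce
  then show "finite (\<Union>\<B>)" using G finite_subset by (auto simp: simple_graph_def)
  have \<B>: "\<B> = (\<lambda>v. {v}) ` \<Union>\<B>" using singleton by fastforce
  show "card (\<Union>\<B>) = card \<B>" by (subst (2) \<B>) (simp add: card_image)
  have "{x, y} \<in> edges G" if "x \<in> \<Union>\<B>" "y \<in> \<Union>\<B>" "x \<noteq> y" for x y
  proof -
    have "{x} \<in> \<B>" "{y} \<in> \<B>" using that \<B> by blast+
    then show ?thesis
      using model that(3) by (auto simp: clique_model_def pairwise_def joined_def)
  qed
  then have "[\<Union>\<B>]\<^bsup>2\<^esup> \<subseteq> edges G" by (auto elim!: nsets2_E)
  then have "{e \<in> edges G. e \<subseteq> \<Union>\<B>} = [\<Union>\<B>]\<^bsup>2\<^esup>"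
    using edges_subset_nsets[OF G] by (auto simp: nsets_def)
  then show "induced_subgraph G (\<Union>\<B>) = complete_graph (\<Union>\<B>)"
    using V by (simp add: induced_subgraph_def complete_graph_def Int_absorb1)
qed

lemma clique_model_imp_complete_minor:
  assumes "graph_class \<H>" "minor_closed \<H>" "G \<in> \<H>" "clique_model G \<B>"
  obtains V where "finite V" "card V = card \<B>" "complete_graph V \<in> \<H>"
  using assms(3,4)
proof (induction "card (verts G)" arbitrary: G \<B> thesis rule: less_induct)
  case (less G \<B>)
  have G: "simple_graph G" using less.prems(2) assms(1) by (simp add: graph_class_def)
  show ?case
  proof (cases "\<B> \<inter> edges G = {}")
    case True
    then show ?thesis
      using clique_model_no_edge[OF G less.prems(3)] less.prems(1)
        minor_closed_induced_subgraph[OF assms(2) less.prems(2) G] by metis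
  next
    case False
    then obtain a b where ab: "{a, b} \<in> \<B>" "{a, b} \<in> edges G" "a \<noteq> b" "b \<in> verts G"
      using simple_graph_edgeE[OF G] by (metis disjoint_iff)
    let ?H = "contract_edge G a b"
    let ?\<C> = "(`) (merge a b) ` \<B>"
    have "clique_model ?H ?\<C>" by (rule clique_model_contract_edge[OF G less.prems(3) ab(1,2)])
    moreover have "card ?\<C> = card \<B>"
      using ab(1) less.prems(3)
      by (intro card_image image_merge_disjoint(3)) (auto simp: clique_model_def)
    moreover have "has_minor G ?H" using ab by (intro has_minor.contract_edge has_minor.refl)
    then have "?H \<in> \<H>" using less.prems(2) assms(2) by (auto simp: minor_closed_def)
    moreover have "card (verts ?H) < card (verts G)"
      using card_Diff1_less[of "verts G" b] G ab(4) by (simp add: simple_graph_def)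
    ultimately show ?thesis using less.hyps[of ?H ?\<C>] less.prems(1) by metis
  qed
qed

section \<open>Large matchings\<close>

lemma matching_disjoint: "matching G M \<Longrightarrow> disjoint M"
  by (auto simp: matching_def pairwise_def disjnt_def)

lemma matching_eqI: "matching G M \<Longrightarrow> e \<in> M \<Longrightarrow> f \<in> M \<Longrightarrow> x \<in> e \<Longrightarrow> x \<in> f \<Longrightarrow> e = f"
  unfolding matching_def by blast

lemma matching_subset: "matching G M \<Longrightarrow> N \<subseteq> M \<Longrightarrow> matching G N"
  unfolding matching_def by blast

lemma finite_matching: "simple_graph G \<Longrightarrow> matching G M \<Longrightarrow> finite M"
  using finite_edges finite_subset by (auto simp: matching_def)

lemma matching_Union_subset: "simple_graph G \<Longrightarrow> matching G M \<Longrightarrow> \<Union>M \<subseteq> verts G"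
  using edges_subset_nsets by (fastforce simp: matching_def nsets_def)

lemma sum_matching:
  assumes "simple_graph G" "matching G M"
  shows "(\<Sum>x\<in>\<Union>M. f x) = (\<Sum>e\<in>M. \<Sum>x\<in>e. f x)"
proof -
  have "finite e" if "e \<in> M" for e
    using assms that edges_subset_nsets by (fastforce simp: matching_def nsets_def)
  then show ?thesis
    using assms(2) by (intro sum.Union_disjoint[unfolded o_def]) (auto simp: matching_def)
qed

lemma card_Union_matching:
  assumes "simple_graph G" "matching G M"
  shows "card (\<Union>M) = 2 * card M"
proof -
  have "card e = 2" if "e \<in> M" for e
    using assms that edges_subset_nsets by (fastforce simp: matching_def nsets_def)
  then show ?thesis using sum_matching[OF assms, of "\<lambda>_. 1 :: nat"] by simp
qed

definition separated :: "'a sgraph \<Rightarrow> 'a set set \<Rightarrow> bool" where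
  "separated G M \<longleftrightarrow> pairwise (\<lambda>e f. \<not> joined G e f) M"

lemma induced_matching_iff_separated:
  assumes G: "simple_graph G" and M: "matching G M"
  shows "induced_matching G M \<longleftrightarrow> separated G M"
proof -
  let ?E = "edges (induced_subgraph G (\<Union>M))"
  have "M \<subseteq> ?E" using M by (auto simp: matching_def induced_subgraph_def)
  then have "induced_matching G M \<longleftrightarrow> ?E = M"
    using M finite_edges[OF simple_graph_induced_subgraph[OF G]] card_subset_eq[of ?E M]
    by (auto simp: induced_matching_def)
  also have "\<dots> \<longleftrightarrow> separated G M"
  proof
    assume E: "?E = M"
    have "e = f" if "e \<in> M" "f \<in> M" "x \<in> e" "y \<in> f" "{x, y} \<in> edges G" for e f x y
    proof -
      have "{x, y} \<in> M" using that E by (auto simp: induced_subgraph_def)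
      then show ?thesis using matching_eqI[OF M] that(1-4) by (metis insertI1 insertI2)
    qed
    then show "separated G M" by (auto simp: separated_def pairwise_def joined_def)
  next
    assume sep: "separated G M"
    have "g \<in> M" if g: "g \<in> ?E" for g
    proof -
      have "g \<in> edges G" using g by (simp add: induced_subgraph_def)
      then obtain x y where xy: "x \<noteq> y" "g = {x, y}" "{x, y} \<in> edges G"
        using simple_graph_edgeE[OF G] by metis
      obtain e f where ef: "e \<in> M" "x \<in> e" "f \<in> M" "y \<in> f"
        using g xy(2) by (auto simp: induced_subgraph_def)
      have "e = f" using sep ef xy(3) by (auto simp: separated_def pairwise_def joined_def)
      moreover have "e \<in> edges G" using ef M by (auto simp: matching_def)
      ultimately have "e = {x, y}" using ef xy(1) by (auto elim!: simple_graph_edgeE[OF G])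
      then show ?thesis using ef xy by simp
    qed
    then show "?E = M" using \<open>M \<subseteq> ?E\<close> by blast
  qed
  finally show ?thesis .
qed

lemma ramsey2_choose:
  assumes "finite V" "(m + n) choose m \<le> card V"
  obtains W where "W \<subseteq> V" "card W = m \<and> clique W E \<or> card W = n \<and> indep W E"
proof -
  let ?N = "(m + n) choose m"
  obtain v where v: "inj_on v {..<?N}" "v ` {..<?N} \<subseteq> V"
    using card_le_inj[of "{..<?N}" V] assms by auto
  define colour where "colour e = (if v ` e \<in> E then 0 else 1 :: nat)" for e
  have "partn_lst {..<?N} [m, n] 2" using ramsey2_full[of 2 m n] by (simp add: ES2_choose)
  moreover have "colour \<in> [{..<?N}]\<^bsup>2\<^esup> \<rightarrow> {..<2}" by (simp add: colour_def)
  moreover have "length [m, n] = 2" by simp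
  ultimately obtain i U where "i < length [m, n]"
    and U: "U \<in> [{..<?N}]\<^bsup>([m, n] ! i)\<^esup>" "colour ` [U]\<^bsup>2\<^esup> \<subseteq> {i}"
    by (rule partn_lstE)
  have "U \<subseteq> {..<?N}" "card U = [m, n] ! i" using U(1) by (auto simp: nsets_def)
  then have "v ` U \<subseteq> V" "card (v ` U) = [m, n] ! i"
    using v by (auto simp: card_image inj_on_subset)
  moreover have "{v a, v b} \<in> E \<longleftrightarrow> i = 0" if "a \<in> U" "b \<in> U" "a \<noteq> b" for a b
  proof -
    have "colour {a, b} = i" using U(2) that by (auto simp: image_subset_iff)
    then show ?thesis by (auto simp: colour_def split: if_splits)
  qed
  then have "if i = 0 then clique (v ` U) E else indep (v ` U) E"
    by (auto simp: clique_def indep_def)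
  ultimately show thesis using that[of "v ` U"] \<open>i < length [m, n]\<close>
    by (cases "i = 0") (auto simp: less_Suc_eq)
qed

lemma large_matching_imp_separated_subset:
  assumes "graph_class \<H>" "minor_closed \<H>" "excludes_clique \<H> h"
    and G: "G \<in> \<H>" and M: "matching G M" "2 ^ (h + k) \<le> card M"
  shows "\<exists>N\<subseteq>M. card N = k \<and> separated G N"
proof -
  define E where "E = {{e, f} | e f. joined G e f}"
  have E_iff: "{e, f} \<in> E \<longleftrightarrow> joined G e f" for e f
    by (auto simp: E_def doubleton_eq_iff joined_commute[of G e f])
  have "simple_graph G" using G assms(1) by (simp add: graph_class_def)
  then have "finite M" using M(1) by (rule finite_matching)
  moreover have "(h + k) choose h \<le> card M" using binomial_le_pow2[of "h + k" h] M(2) by simp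
  ultimately obtain N where N: "N \<subseteq> M" "card N = h \<and> clique N E \<or> card N = k \<and> indep N E"
    by (rule ramsey2_choose)
  from N(2) show ?thesis
  proof
    assume clique: "card N = h \<and> clique N E"
    then have "pairwise (joined G) N" by (simp add: clique_def E_iff pairwise_def)
    moreover have "matching G N" using matching_subset[OF M(1) N(1)] .
    ultimately have "clique_model G N"
      using matching_disjoint by (auto simp: clique_model_def matching_def)
    then obtain V where "finite V" "card V = h" "complete_graph V \<in> \<H>"
      using clique_model_imp_complete_minor[OF assms(1,2) G] clique by metis
    then show ?thesis using assms(3) by (auto simp: excludes_clique_def)
  next
    assume "card N = k \<and> indep N E"
    then show ?thesis
      using N(1) by (auto simp: indep_def E_iff separated_def pairwise_def)
  qed
qed

section \<open>Forests\<close>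

definition nbrs :: "'a sgraph \<Rightarrow> 'a \<Rightarrow> 'a set" where
  "nbrs G v = {w. {v, w} \<in> edges G}"

lemma nbrs_subset: "simple_graph G \<Longrightarrow> nbrs G v \<subseteq> verts G"
  by (auto simp: nbrs_def dest: simple_graph_edgeD)

lemma finite_nbrs: "simple_graph G \<Longrightarrow> finite (nbrs G v)"
  using nbrs_subset finite_subset unfolding simple_graph_def by metis

lemma card_nbrs:
  assumes "simple_graph G"
  shows "card (nbrs G v) = card {e \<in> edges G. v \<in> e}"
proof (rule bij_betw_same_card[of "\<lambda>w. {v, w}"], rule bij_betw_imageI)
  show "inj_on (\<lambda>w. {v, w}) (nbrs G v)" by (auto simp: inj_on_def doubleton_eq_iff)
  show "(\<lambda>w. {v, w}) ` nbrs G v = {e \<in> edges G. v \<in> e}"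
  proof (intro equalityI subsetI)
    fix e assume e: "e \<in> {e \<in> edges G. v \<in> e}"
    then obtain a b where "e = {a, b}" using simple_graph_edgeE[OF assms] by blast
    then show "e \<in> (\<lambda>w. {v, w}) ` nbrs G v" using e by (auto simp: nbrs_def insert_commute)
  qed (auto simp: nbrs_def)
qed

lemma handshake:
  assumes "simple_graph G"
  shows "(\<Sum>v\<in>verts G. card (nbrs G v)) = 2 * card (edges G)"
proof -
  have "card {v \<in> verts G. v \<in> e} = 2" if "e \<in> edges G" for e
  proof -
    have "e \<in> [verts G]\<^bsup>2\<^esup>" using that edges_subset_nsets[OF assms] by blast
    then have "{v \<in> verts G. v \<in> e} = e" "card e = 2" by (auto simp: nsets_def)
    then show ?thesis by simp
  qed
  then have "(\<Sum>v\<in>verts G. card {e \<in> edges G. v \<in> e}) = 2 * card (edges G)"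
    using assms finite_edges[OF assms] by (intro sum_multicount) (auto simp: simple_graph_def)
  then show ?thesis by (simp add: card_nbrs[OF assms])
qed

lemma acyclic_graph_mono:
  assumes "acyclic_graph G" "verts H \<subseteq> verts G" "edges H \<subseteq> edges G"
  shows "acyclic_graph H"
  using assms unfolding acyclic_graph_def is_cycle_def by (meson order_trans subsetD)

lemma is_cycle_iff_successively:
  "is_cycle G p \<longleftrightarrow> 3 \<le> length p \<and> distinct p \<and> set p \<subseteq> verts G \<and>
     successively (\<lambda>u v. {u, v} \<in> edges G) p \<and> {last p, hd p} \<in> edges G"
  by (simp add: is_cycle_def successively_conv_nth)

lemma is_cycle_induced_subgraph:
  "is_cycle (induced_subgraph G S) p \<longleftrightarrow> is_cycle G p \<and> set p \<subseteq> S"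
proof (cases "p \<noteq> [] \<and> set p \<subseteq> S")
  case True
  then have "last p \<in> S" "hd p \<in> S" by auto
  moreover have "successively (\<lambda>u v. {u, v} \<in> edges G \<and> {u, v} \<subseteq> S) p \<longleftrightarrow>
      successively (\<lambda>u v. {u, v} \<in> edges G) p"
    using True by (intro successively_cong) auto
  ultimately show ?thesis using True by (simp add: is_cycle_iff_successively induced_subgraph_def)
qed (auto simp: is_cycle_iff_successively induced_subgraph_def)

lemma is_cycle_append_commute: "is_cycle G (p @ q) \<Longrightarrow> is_cycle G (q @ p)"
  by (cases "p = []"; cases "q = []")
    (auto simp: is_cycle_iff_successively successively_append_iff)

lemma cycle_imp_two_nbrs:
  assumes "is_cycle G p" "x \<in> set p"
  obtains u w where "u \<noteq> w" "{x, u} \<in> edges G" "{x, w} \<in> edges G"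
proof -
  obtain us vs where p: "p = us @ x # vs" using assms(2) by (meson split_list)
  let ?q = "vs @ us"
  have cycle: "is_cycle G (x # ?q)"
    using is_cycle_append_commute[of G us "x # vs"] assms(1) p by simp
  then obtain y z zs where q: "?q = y # z # zs"
    by (cases ?q; cases "tl ?q") (auto simp: is_cycle_def)
  have "{x, hd ?q} \<in> edges G" "{x, last ?q} \<in> edges G" "hd ?q \<noteq> last ?q"
    using cycle unfolding q is_cycle_iff_successively by (auto simp: insert_commute)
  then show thesis by (intro that)
qed

definition simple_path :: "'a sgraph \<Rightarrow> 'a list \<Rightarrow> bool" where
  "simple_path G p \<longleftrightarrow> p \<noteq> [] \<and> distinct p \<and> set p \<subseteq> verts G \<and>
     successively (\<lambda>u v. {u, v} \<in> edges G) p"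

lemma ex_longest_simple_path:
  assumes "finite (verts G)" "verts G \<noteq> {}"
  obtains p where "simple_path G p" "\<And>q. simple_path G q \<Longrightarrow> length q \<le> length p"
proof -
  obtain v where "v \<in> verts G" using assms(2) by blast
  then have "simple_path G [v]" by (simp add: simple_path_def)
  moreover have "\<forall>p. simple_path G p \<longrightarrow> length p < Suc (card (verts G))"
    using assms(1) unfolding simple_path_def
    by (metis card_mono distinct_card less_Suc_eq_le)
  ultimately show thesis
    using ex_has_greatest_nat[of "simple_path G" "[v]" length "Suc (card (verts G))"] that by blast
qed

lemma acyclic_graph_exists_leaf:
  assumes G: "simple_graph G" and acyclic: "acyclic_graph G" and "verts G \<noteq> {}"
  obtains v where "v \<in> verts G" "card (nbrs G v) \<le> 1"
proof -
  have "finite (verts G)" using G by (simp add: simple_graph_def)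
  then obtain p where p: "simple_path G p" and longest: "\<And>q. simple_path G q \<Longrightarrow> length q \<le> length p"
    using ex_longest_simple_path assms(3) by blast
  obtain x xs where px: "p = x # xs" using p by (cases p) (auto simp: simple_path_def)
  have nbr_in_path: "w \<in> set xs" if w: "{x, w} \<in> edges G" for w
  proof (rule ccontr)
    assume "w \<notin> set xs"
    then have "simple_path G (w # p)"
      using p px simple_graph_edgeD[OF G w] w by (auto simp: simple_path_def insert_commute)
    then show False using longest by force
  qed
  have "w = hd xs" if w: "{x, w} \<in> edges G" for w
  proof (rule ccontr)
    assume "w \<noteq> hd xs"
    moreover obtain us vs where xs: "xs = us @ w # vs"
      using nbr_in_path[OF w] by (meson split_list)
    ultimately have "us \<noteq> []" by auto
    then have "is_cycle G (x # us @ [w])"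
      using p px xs w unfolding is_cycle_iff_successively simple_path_def
      by (auto simp: successively_append_iff successively_Cons insert_commute Suc_le_eq)
    then show False using acyclic by (auto simp: acyclic_graph_def)
  qed
  then have "nbrs G x \<subseteq> {hd xs}" by (auto simp: nbrs_def)
  then have "card (nbrs G x) \<le> 1" using card_mono[of "{hd xs}" "nbrs G x"] by simp
  moreover have "x \<in> verts G" using p px by (simp add: simple_path_def)
  ultimately show thesis by (rule that[rotated])
qed

lemma card_edges_acyclic_graph:
  assumes "simple_graph G" "acyclic_graph G" "verts G \<noteq> {}"
  shows "card (edges G) < card (verts G)"
  using assms
proof (induction "card (verts G)" arbitrary: G rule: less_induct)
  case (less G)
  note G = less.prems(1)
  have fin: "finite (verts G)" using G by (simp add: simple_graph_def)
  obtain v where v: "v \<in> verts G" "card (nbrs G v) \<le> 1"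
    using acyclic_graph_exists_leaf[OF less.prems] .
  let ?H = "delete_vertex G v"
  have H: "verts ?H = verts G - {v}" "edges ?H \<subseteq> edges G" by (auto simp: delete_vertex_def)
  have "edges G = edges ?H \<union> {e \<in> edges G. v \<in> e}" by (auto simp: delete_vertex_def)
  then have card_edges: "card (edges G) \<le> card (edges ?H) + card (nbrs G v)"
    using card_Un_le unfolding card_nbrs[OF G] by metis
  show ?case
  proof (cases "verts ?H = {}")
    case True
    then have "verts G = {v}" using v(1) H(1) by blast
    moreover from this have "edges G = {}"
      using edges_subset_nsets[OF G] by (simp add: nsets_singleton_iff)
    ultimately show ?thesis by simp
  next
    case False
    have "card (verts ?H) < card (verts G)" using card_Diff1_less[OF fin v(1)] H(1) by simp
    moreover have "acyclic_graph ?H" using acyclic_graph_mono[OF less.prems(2)] H by blast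
    ultimately have "card (edges ?H) < card (verts ?H)"
      using less.hyps simple_graph_delete_vertex[OF G] False by blast
    moreover have "card (verts G) = Suc (card (verts ?H))"
      using H(1) card_Suc_Diff1[OF fin v(1)] by simp
    ultimately show ?thesis using card_edges v(2) by linarith
  qed
qed

lemma acyclic_insert_leaf:
  assumes G: "simple_graph G" and acyclic: "acyclic_graph (induced_subgraph G V)"
    and leaf: "card (nbrs G x \<inter> V) \<le> 1"
  shows "acyclic_graph (induced_subgraph G (insert x V))"
proof (rule ccontr)
  let ?H = "induced_subgraph G (insert x V)"
  assume "\<not> ?thesis"
  then obtain p where p: "is_cycle ?H p" by (auto simp: acyclic_graph_def)
  show False
  proof (cases "x \<in> set p")
    case True
    obtain u w where uw: "u \<noteq> w" "{x, u} \<in> edges ?H" "{x, w} \<in> edges ?H"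
      using cycle_imp_two_nbrs[OF p True] .
    have "v \<in> nbrs G x \<inter> V" if "{x, v} \<in> edges ?H" for v
      using that simple_graph_edgeD(1)[OF G, of x v] by (auto simp: induced_subgraph_def nbrs_def)
    then have "{u, w} \<subseteq> nbrs G x \<inter> V" using uw by blast
    then show False
      using card_mono[of "nbrs G x \<inter> V" "{u, w}"] finite_nbrs[OF G] leaf uw(1) by simp
  next
    case False
    then have "is_cycle (induced_subgraph G V) p"
      using p by (auto simp: is_cycle_induced_subgraph)
    then show False using acyclic by (auto simp: acyclic_graph_def)
  qed
qed

section \<open>Matchings as degenerate sequences of pairs\<close>

definition adj :: "'a sgraph \<Rightarrow> 'a \<Rightarrow> 'a \<Rightarrow> nat" where
  "adj G u v = of_bool ({u, v} \<in> edges G)"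

lemma adj_eq_0_iff [simp]: "adj G u v = 0 \<longleftrightarrow> {u, v} \<notin> edges G"
  by (simp add: adj_def)

fun cross_edges :: "'a sgraph \<Rightarrow> 'a \<Rightarrow> 'a \<Rightarrow> ('a \<times> 'a) list \<Rightarrow> nat" where
  "cross_edges G a b [] = 0"
| "cross_edges G a b ((p, q) # ps) =
     adj G a p + adj G b p + adj G a q + adj G b q + cross_edges G a b ps"

text \<open>The name refers to degenerate graphs, which are defined by few edges to later vertices.\<close>

fun degenerate_matching :: "'a sgraph \<Rightarrow> nat \<Rightarrow> ('a \<times> 'a) list \<Rightarrow> bool" where
  "degenerate_matching G r [] \<longleftrightarrow> True"
| "degenerate_matching G r ((a, b) # ps) \<longleftrightarrow>
     {a, b} \<in> edges G \<and> cross_edges G a b ps \<le> r \<and> degenerate_matching G r ps"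

definition pair_edges :: "('a \<times> 'a) list \<Rightarrow> 'a set set" where
  "pair_edges ps = (\<lambda>(a, b). {a, b}) ` set ps"

lemma pair_edges_simps [simp]:
  "pair_edges [] = {}"
  "pair_edges ((a, b) # ps) = insert {a, b} (pair_edges ps)"
  by (auto simp: pair_edges_def)

lemma finite_Union_pair_edges: "finite (\<Union>(pair_edges ps))"
  by (auto simp: pair_edges_def)

lemma cross_edges_ge:
  "(p, q) \<in> set ps \<Longrightarrow> adj G a p + adj G b p + adj G a q + adj G b q \<le> cross_edges G a b ps"
  by (induction ps) auto

lemma cross_edges_eq_0_iff:
  "cross_edges G a b ps = 0 \<longleftrightarrow> (\<forall>e\<in>pair_edges ps. \<not> joined G {a, b} e)"
  by (induction ps) (auto simp: joined_def)

lemma degenerate_matching_mono: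
  "degenerate_matching G r ps \<Longrightarrow> r \<le> s \<Longrightarrow> degenerate_matching G s ps"
  by (induction G r ps rule: degenerate_matching.induct) auto

lemma degenerate_matching_subset_edges: "degenerate_matching G r ps \<Longrightarrow> pair_edges ps \<subseteq> edges G"
  by (induction G r ps rule: degenerate_matching.induct) auto

text \<open>A vertex shared with a later pair already causes two edges to that pair.\<close>

lemma few_cross_edges_imp_disjoint:
  assumes "degenerate_matching G r ps" "{a, b} \<in> edges G" "cross_edges G a b ps \<le> 1"
  shows "a \<notin> \<Union>(pair_edges ps)" "b \<notin> \<Union>(pair_edges ps)"
proof -
  have "z \<noteq> p \<and> z \<noteq> q" if pq: "(p, q) \<in> set ps" and z: "z = a \<or> z = b" for p q z
  proof -
    have "{p, q} \<in> edges G"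
      using degenerate_matching_subset_edges[OF assms(1)] pq by (auto simp: pair_edges_def)
    then show ?thesis
      using cross_edges_ge[OF pq, of G a b] assms(2,3) z
      by (auto simp: adj_def insert_commute split: if_splits)
  qed
  then show "a \<notin> \<Union>(pair_edges ps)" "b \<notin> \<Union>(pair_edges ps)"
    unfolding pair_edges_def by auto
qed

lemma degenerate_matching_imp_matching:
  assumes "degenerate_matching G r ps" "r \<le> 1"
  shows "matching G (pair_edges ps) \<and> card (pair_edges ps) = length ps"
  using assms
proof (induction G r ps rule: degenerate_matching.induct)
  case (1 G r)
  show ?case by (simp add: matching_def)
next
  case (2 G r a b ps)
  have "cross_edges G a b ps \<le> 1" using "2.prems" by simp
  then have off: "a \<notin> \<Union>(pair_edges ps)" "b \<notin> \<Union>(pair_edges ps)"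
    using few_cross_edges_imp_disjoint[of G r ps a b] "2.prems"(1) by auto
  have "matching G (pair_edges ps)" "{a, b} \<in> edges G" using 2 by auto
  moreover have "{a, b} \<inter> f = {}" if "f \<in> pair_edges ps" for f using off that by auto
  ultimately have "matching G (insert {a, b} (pair_edges ps))"
    unfolding matching_def by auto
  moreover have "{a, b} \<notin> pair_edges ps" using off by auto
  moreover have "finite (pair_edges ps)" by (simp add: pair_edges_def)
  ultimately show ?case using 2 by simp
qed

lemma card_nbrs_Int_insert:
  assumes "finite V" "w \<notin> V"
  shows "card (nbrs G v \<inter> insert w V) = adj G v w + card (nbrs G v \<inter> V)"
  using assms by (cases "{v, w} \<in> edges G") (auto simp: nbrs_def adj_def)

definition degree_into :: "'a sgraph \<Rightarrow> 'a set \<Rightarrow> 'a set \<Rightarrow> nat" where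
  "degree_into G A V = (\<Sum>x\<in>A. card (nbrs G x \<inter> V))"

lemma degree_into_insert:
  assumes "finite V" "w \<notin> V"
  shows "degree_into G A (insert w V) = (\<Sum>x\<in>A. adj G x w) + degree_into G A V"
  by (simp add: degree_into_def card_nbrs_Int_insert[OF assms] sum.distrib)

lemma cross_edges_eq_degree_into:
  assumes "simple_graph G" "degenerate_matching G r ps" "r \<le> 1" "a \<noteq> b"
  shows "cross_edges G a b ps = degree_into G {a, b} (\<Union>(pair_edges ps))"
  using assms(2)
proof (induction ps)
  case (Cons pq ps)
  obtain p q where [simp]: "pq = (p, q)" by (cases pq)
  let ?V = "\<Union>(pair_edges ps)"
  have "cross_edges G p q ps \<le> 1" using Cons.prems assms(3) by simp
  then have "p \<notin> ?V" "q \<notin> ?V"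
    using few_cross_edges_imp_disjoint[of G r ps p q] Cons.prems by auto
  moreover have "p \<noteq> q" using Cons.prems simple_graph_edgeD[OF assms(1)] by auto
  ultimately have "degree_into G {a, b} (insert p (insert q ?V)) =
      adj G a p + adj G b p + (adj G a q + adj G b q + degree_into G {a, b} ?V)"
    using finite_Union_pair_edges[of ps] assms(4) by (simp add: degree_into_insert del: Union_iff)
  then show ?case using Cons by simp
qed (simp add: degree_into_def)

lemma degenerate_matching_imp_separated:
  "degenerate_matching G 0 ps \<Longrightarrow> separated G (pair_edges ps)"
  by (induction G "0 :: nat" ps rule: degenerate_matching.induct)
    (auto simp: separated_def pairwise_insert cross_edges_eq_0_iff joined_commute[of _ _ "{_, _}"])

lemma degenerate_matching_imp_acyclic:
  assumes "simple_graph G" "degenerate_matching G 1 ps"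
  shows "acyclic_graph (induced_subgraph G (\<Union>(pair_edges ps)))"
  using assms(2)
proof (induction ps)
  case Nil
  then show ?case by (auto simp: acyclic_graph_def is_cycle_def induced_subgraph_def)
next
  case (Cons pq ps)
  obtain p q where [simp]: "pq = (p, q)" by (cases pq)
  let ?V = "\<Union>(pair_edges ps)"
  have acyclic: "acyclic_graph (induced_subgraph G ?V)" using Cons by simp
  have insert_pair: "acyclic_graph (induced_subgraph G (insert b (insert a ?V)))"
    if "card (nbrs G a \<inter> ?V) \<le> 1" "card (nbrs G b \<inter> ?V) = 0" for a b
  proof -
    have "nbrs G b \<inter> insert a ?V \<subseteq> {a}"
      using that(2) finite_nbrs[OF assms(1)] by auto
    then have "card (nbrs G b \<inter> insert a ?V) \<le> 1" using card_mono[of "{a}"] by fastforce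
    then show ?thesis using acyclic_insert_leaf[OF assms(1)] acyclic that(1) by metis
  qed
  have "card (nbrs G p \<inter> ?V) + card (nbrs G q \<inter> ?V) \<le> 1"
    using Cons.prems cross_edges_eq_degree_into[OF assms(1), of 1 ps p q]
      simple_graph_edgeD(1)[OF assms(1), of p q] by (simp add: degree_into_def)
  then consider "card (nbrs G p \<inter> ?V) \<le> 1" "card (nbrs G q \<inter> ?V) = 0"
    | "card (nbrs G q \<inter> ?V) \<le> 1" "card (nbrs G p \<inter> ?V) = 0"
    by linarith
  then show ?case
  proof cases
    case 1
    then show ?thesis using insert_pair[of p q] by (simp add: insert_commute)
  next
    case 2
    then show ?thesis using insert_pair[of q p] by simp
  qed
qed

lemma ex_degenerate_matching:
  assumes G: "simple_graph G" and M: "matching G M" and r: "r \<le> 1"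
    and few: "\<And>N. N \<subseteq> M \<Longrightarrow> N \<noteq> {} \<Longrightarrow> \<exists>e\<in>N. degree_into G e (\<Union>(N - {e})) \<le> r"
  shows "\<exists>ps. degenerate_matching G r ps \<and> pair_edges ps = M \<and> length ps = card M"
  using finite_matching[OF G M] M few
proof (induction M rule: finite_psubset_induct)
  case (psubset M)
  show ?case
  proof (cases "M = {}")
    case True
    then show ?thesis by (auto intro!: exI[of _ "[]"])
  next
    case False
    then obtain e where e: "e \<in> M" "degree_into G e (\<Union>(M - {e})) \<le> r"
      using psubset.prems(2)[of M] by blast
    have "e \<in> edges G" using e(1) psubset.prems(1) by (auto simp: matching_def)
    then obtain a b where ab: "e = {a, b}" "a \<noteq> b" using simple_graph_edgeE[OF G] by metis
    have "\<exists>ps. degenerate_matching G r ps \<and> pair_edges ps = M - {e} \<and> length ps = card (M - {e})"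
    proof (rule psubset.IH)
      show "M - {e} \<subset> M" using e(1) by blast
      then show "matching G (M - {e})" using matching_subset[OF psubset.prems(1)] by blast
    qed (rule psubset.prems(2), blast)
    then obtain ps where
      ps: "degenerate_matching G r ps" "pair_edges ps = M - {e}" "length ps = card (M - {e})"
      by blast
    then have "degenerate_matching G r ((a, b) # ps)"
      using \<open>e \<in> edges G\<close> e(2) ab(1) cross_edges_eq_degree_into[OF G ps(1) r ab(2)] by simp
    moreover have "pair_edges ((a, b) # ps) = M" using ps(2) ab(1) e(1) by auto
    moreover have "length ((a, b) # ps) = card M"
      using ps(3) card_Suc_Diff1[OF psubset.hyps e(1)] by simp
    ultimately show ?thesis by blast
  qed
qed

lemma separated_imp_degenerate_matching:
  assumes G: "simple_graph G" and M: "matching G M" and sep: "separated G M"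
  shows "\<exists>ps. degenerate_matching G 0 ps \<and> pair_edges ps = M \<and> length ps = card M"
proof (rule ex_degenerate_matching[OF G M])
  fix N assume N: "N \<subseteq> M" "N \<noteq> {}"
  then obtain e where e: "e \<in> N" by blast
  have "nbrs G x \<inter> \<Union>(N - {e}) = {}" if "x \<in> e" for x
  proof -
    have "\<not> joined G e f" if "f \<in> N - {e}" for f
      using sep that N(1) e by (auto simp: separated_def pairwise_def)
    then show ?thesis using \<open>x \<in> e\<close> by (auto simp: joined_def nbrs_def)
  qed
  then have "degree_into G e (\<Union>(N - {e})) = 0" by (simp add: degree_into_def)
  then show "\<exists>e\<in>N. degree_into G e (\<Union>(N - {e})) \<le> 0" using e by (intro bexI[of _ e]) simp_all
qed simp

lemma degree_into_matching:
  assumes G: "simple_graph G" and M: "matching G M" and e: "e \<in> M"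
  shows "degree_into G e (\<Union>M) = 2 + degree_into G e (\<Union>(M - {e}))"
proof -
  have "e \<in> edges G" using M e by (auto simp: matching_def)
  then obtain a b where ab: "e = {a, b}" "a \<noteq> b" "{a, b} \<in> edges G"
    using simple_graph_edgeE[OF G] by metis
  let ?W = "\<Union>(M - {e})"
  have "\<Union>M = insert a (insert b ?W)" using e ab(1) by auto
  moreover have "a \<notin> insert b ?W" "b \<notin> ?W" using matching_eqI[OF M e] ab(1,2) by auto
  moreover have "finite ?W"
    using G matching_Union_subset[OF G M] by (auto simp: simple_graph_def intro: finite_subset)
  ultimately have "degree_into G e (\<Union>M) =
      (\<Sum>x\<in>e. adj G x a) + ((\<Sum>x\<in>e. adj G x b) + degree_into G e ?W)"
    by (simp add: degree_into_insert del: Union_iff)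
  moreover have "adj G a a = 0" "adj G b b = 0" "adj G a b = 1" "adj G b a = 1"
    using ab(3) simple_graph_edgeD(1)[OF G, of a a] simple_graph_edgeD(1)[OF G, of b b]
    by (auto simp: adj_def insert_commute)
  ultimately show ?thesis using ab(1,2) by simp
qed

lemma sum_degree_into_matching:
  assumes G: "simple_graph G" and M: "matching G M"
  shows "(\<Sum>e\<in>M. degree_into G e (\<Union>M)) = 2 * card (edges (induced_subgraph G (\<Union>M)))"
proof -
  let ?H = "induced_subgraph G (\<Union>M)"
  have "verts ?H = \<Union>M"
    using matching_Union_subset[OF G M] by (auto simp: induced_subgraph_def)
  moreover have "nbrs ?H x = nbrs G x \<inter> \<Union>M" if "x \<in> \<Union>M" for x
    using that by (auto simp: nbrs_def induced_subgraph_def)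
  ultimately show ?thesis
    using handshake[OF simple_graph_induced_subgraph[OF G], of "\<Union>M"]
    by (simp add: degree_into_def sum_matching[OF G M])
qed

text \<open>A forest has fewer edges than vertices, so the ends of a matching edge have fewer than four
  neighbours on average.\<close>

lemma acyclic_matching_ex_degree_into_le:
  assumes G: "simple_graph G" and M: "acyclic_matching G M" and "M \<noteq> {}"
  shows "\<exists>e\<in>M. degree_into G e (\<Union>(M - {e})) \<le> 1"
proof -
  let ?H = "induced_subgraph G (\<Union>M)"
  have match: "matching G M" and acyclic: "acyclic_graph ?H"
    using M by (auto simp: acyclic_matching_def)
  have "verts ?H = \<Union>M"
    using matching_Union_subset[OF G match] by (auto simp: induced_subgraph_def)
  moreover have "card M > 0" using finite_matching[OF G match] assms(3) by (simp add: card_gt_0_iff)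
  then have "\<Union>M \<noteq> {}" using card_Union_matching[OF G match] by fastforce
  ultimately have "card (edges ?H) < 2 * card M"
    using card_edges_acyclic_graph[OF simple_graph_induced_subgraph[OF G] acyclic]
      card_Union_matching[OF G match] by simp
  then have "(\<Sum>e\<in>M. degree_into G e (\<Union>M)) < 4 * card M"
    using sum_degree_into_matching[OF G match] by simp
  then obtain e where e: "e \<in> M" "degree_into G e (\<Union>M) < 4"
    using sum_bounded_below[of M 4 "\<lambda>e. degree_into G e (\<Union>M)"] by (fastforce simp: not_less)
  then show ?thesis using degree_into_matching[OF G match e(1)] by (intro bexI[of _ e]) simp_all
qed

lemma acyclic_matching_imp_degenerate_matching:
  assumes G: "simple_graph G" and M: "acyclic_matching G M"
  shows "\<exists>ps. degenerate_matching G 1 ps \<and> pair_edges ps = M \<and> length ps = card M"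
proof -
  have match: "matching G M" and acyclic: "acyclic_graph (induced_subgraph G (\<Union>M))"
    using M by (simp_all add: acyclic_matching_def)
  have "acyclic_matching G N" if N: "N \<subseteq> M" for N
  proof -
    have "\<Union>N \<subseteq> \<Union>M" using N by (rule Union_mono)
    then have "acyclic_graph (induced_subgraph G (\<Union>N))"
      by (intro acyclic_graph_mono[OF acyclic]) (auto simp: induced_subgraph_def)
    then show ?thesis using matching_subset[OF match N] by (simp add: acyclic_matching_def)
  qed
  then show ?thesis
    by (intro ex_degenerate_matching[OF G match order_refl]
        acyclic_matching_ex_degree_into_le[OF G])
qed

theorem ex_acyclic_matching_iff_degenerate:
  assumes "simple_graph G"
  shows "(\<exists>M. acyclic_matching G M \<and> card M = k) \<longleftrightarrow>
    (\<exists>ps. degenerate_matching G 1 ps \<and> length ps = k)"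
  using acyclic_matching_imp_degenerate_matching[OF assms] degenerate_matching_imp_matching[of G 1]
    degenerate_matching_imp_acyclic[OF assms]
  unfolding acyclic_matching_def by (metis order_refl)

theorem ex_induced_matching_iff_degenerate:
  assumes "simple_graph G"
  shows "(\<exists>M. induced_matching G M \<and> card M = k) \<longleftrightarrow>
    (\<exists>ps. degenerate_matching G 0 ps \<and> length ps = k)" (is "?induced \<longleftrightarrow> ?degenerate")
proof
  assume ?induced
  then obtain M where "matching G M" "separated G M" "card M = k"
    using induced_matching_iff_separated[OF assms] by (auto simp: induced_matching_def)
  then show ?degenerate using separated_imp_degenerate_matching[OF assms] by metis
next
  assume ?degenerate
  then obtain ps where ps: "degenerate_matching G 0 ps" "length ps = k" by blast
  then have "matching G (pair_edges ps)" "card (pair_edges ps) = k"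
    using degenerate_matching_imp_matching[OF ps(1)] by auto
  then show ?induced
    using induced_matching_iff_separated[OF assms] degenerate_matching_imp_separated[OF ps(1)]
    by metis
qed

section \<open>Twins\<close>

lemma degenerate_matching_map_twins:
  assumes twins: "\<And>v. v \<in> V \<Longrightarrow> nbrs G (f v) = nbrs G v"
    and "degenerate_matching G r ps" "set ps \<subseteq> V \<times> V"
  shows "degenerate_matching G r (map (map_prod f f) ps)"
proof -
  have edge_iff: "{f u, f v} \<in> edges G \<longleftrightarrow> {u, v} \<in> edges G" if "u \<in> V" "v \<in> V" for u v
  proof -
    have "{f u, f v} \<in> edges G \<longleftrightarrow> {u, f v} \<in> edges G"
      using twins[OF that(1)] by (auto simp: nbrs_def)
    also have "\<dots> \<longleftrightarrow> {u, v} \<in> edges G"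
      using twins[OF that(2)] by (auto simp: nbrs_def insert_commute)
    finally show ?thesis .
  qed
  have "cross_edges G (f a) (f b) (map (map_prod f f) qs) = cross_edges G a b qs"
    if "a \<in> V" "b \<in> V" "set qs \<subseteq> V \<times> V" for a b qs
    using that by (induction qs) (auto simp: adj_def edge_iff)
  then show ?thesis using assms(2,3) by (induction ps) (auto simp: edge_iff)
qed

definition twin_reps :: "'a :: wellorder sgraph \<Rightarrow> 'a set" where
  "twin_reps G = {v \<in> verts G. \<forall>u\<in>verts G. u < v \<longrightarrow> nbrs G u \<noteq> nbrs G v}"

lemma twin_reps_subset: "twin_reps G \<subseteq> verts G"
  by (auto simp: twin_reps_def)

lemma inj_on_nbrs_twin_reps: "inj_on (nbrs G) (twin_reps G)"
  by (rule linorder_inj_onI) (auto simp: twin_reps_def)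

lemma ex_twin_rep:
  assumes "v \<in> verts G"
  shows "\<exists>u\<in>twin_reps G. nbrs G u = nbrs G v"
proof -
  let ?twin = "\<lambda>u. u \<in> verts G \<and> nbrs G u = nbrs G v"
  have "?twin (Least ?twin)" using assms by (intro LeastI) auto
  moreover have "\<not> ?twin u" if "u < Least ?twin" for u using that by (rule not_less_Least)
  ultimately show ?thesis by (auto simp: twin_reps_def)
qed

lemma ex_vertex_cover:
  assumes G: "simple_graph G" and small: "\<And>M. matching G M \<Longrightarrow> card M \<le> m"
  obtains S where "finite S" "card S \<le> 2 * m" "\<forall>v. v \<notin> S \<longrightarrow> nbrs G v \<subseteq> S"
proof -
  have "matching G {}" by (simp add: matching_def)
  moreover have "\<forall>M. matching G M \<longrightarrow> card M < Suc m" using small by (simp add: less_Suc_eq_le)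
  ultimately obtain M where M: "matching G M" and max: "\<And>N. matching G N \<Longrightarrow> card N \<le> card M"
    using ex_has_greatest_nat[of "matching G" "{}" card "Suc m"] by blast
  have "w \<in> \<Union>M" if v: "v \<notin> \<Union>M" and vw: "{v, w} \<in> edges G" for v w
  proof (rule ccontr)
    assume "w \<notin> \<Union>M"
    then have "matching G (insert {v, w} M)" using M v vw by (auto simp: matching_def)
    moreover have "{v, w} \<notin> M" using v by auto
    ultimately show False using max[of "insert {v, w} M"] finite_matching[OF G M] by simp
  qed
  then have "\<forall>v. v \<notin> \<Union>M \<longrightarrow> nbrs G v \<subseteq> \<Union>M" unfolding nbrs_def by blast
  moreover have "finite (\<Union>M)"
    using G matching_Union_subset[OF G M] finite_subset by (auto simp: simple_graph_def)
  moreover have "card (\<Union>M) \<le> 2 * m" using card_Union_matching[OF G M] small[OF M] by simp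
  ultimately show thesis using that by blast
qed

lemma card_twin_reps_le:
  assumes G: "simple_graph G" and small: "\<And>M. matching G M \<Longrightarrow> card M \<le> m"
  shows "card (twin_reps G) \<le> 2 * m + 2 ^ (2 * m)"
proof -
  obtain S where S: "finite S" "card S \<le> 2 * m" and cover: "\<forall>v. v \<notin> S \<longrightarrow> nbrs G v \<subseteq> S"
    using ex_vertex_cover[OF G small] .
  let ?R = "twin_reps G"
  have "card (?R - S) \<le> card (Pow S)"
    using inj_on_subset[OF inj_on_nbrs_twin_reps Diff_subset] cover S(1)
    by (intro card_inj_on_le[where f = "nbrs G"]) auto
  also have "\<dots> \<le> 2 ^ (2 * m)" using S by (simp add: card_Pow)
  finally have "card (?R - S) \<le> 2 ^ (2 * m)" .
  moreover have "card (?R \<inter> S) \<le> 2 * m" using card_mono[OF S(1), of "?R \<inter> S"] S(2) by simp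
  moreover have "card ?R \<le> card (?R \<inter> S) + card (?R - S)"
    using card_Un_le[of "?R \<inter> S" "?R - S"] by (simp add: Int_Diff_Un)
  ultimately show ?thesis by simp
qed

section \<open>Structured programs for the random access machine\<close>

text \<open>Register 1 is reserved for the constant 1 that decrements the loop counters.\<close>

abbreviation (input) one :: nat where "one \<equiv> 1"

datatype com = Block "instr list" | Seq com com (infixr \<open>;;\<close> 60) | When nat com | For nat com

fun csize :: "com \<Rightarrow> nat" where
  "csize (Block is) = length is"
| "csize (c ;; d) = csize c + csize d"
| "csize (When i c) = Suc (csize c)"
| "csize (For i c) = csize c + 4"

fun compile :: "nat \<Rightarrow> com \<Rightarrow> instr list" where
  "compile a (Block is) = is"
| "compile a (c ;; d) = compile a c @ compile (a + csize c) d"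
| "compile a (When i c) = JumpZero i (a + Suc (csize c)) # compile (a + 1) c"
| "compile a (For i c) =
     [JumpZero i (a + csize c + 4), Const one 1, Sub i i one] @ compile (a + 3) c @ [Jump a]"

lemma length_compile [simp]: "length (compile a c) = csize c"
  by (induction c arbitrary: a) auto

definition input_at :: "nat list \<Rightarrow> nat \<Rightarrow> nat" where
  "input_at x i = (if i < length x then x ! i else 0)"

definition effect :: "nat list \<Rightarrow> instr \<Rightarrow> (nat \<Rightarrow> nat) \<Rightarrow> nat \<Rightarrow> nat" where
  "effect x i R = snd (exec x i (0, R))"

lemma effect_simps [simp]:
  "effect x (Const i c) R = R(i := c)"
  "effect x (Add i j l) R = R(i := R j + R l)"
  "effect x (Sub i j l) R = R(i := R j - R l)"
  "effect x (Half i j) R = R(i := R j div 2)"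
  "effect x (Load i j) R = R(i := R (R j))"
  "effect x (Store i j) R = R(R i := R j)"
  "effect x (Read i j) R = R(i := input_at x (R j))"
  "effect x (Jump a) R = R"
  "effect x (JumpZero i a) R = R"
  by (simp_all add: effect_def input_at_def)

text \<open>\<^const>\<open>foldr\<close> starts at the end of the list, with the counter value \<open>v - 1\<close>.\<close>

definition countdown ::
    "nat \<Rightarrow> ((nat \<Rightarrow> nat) \<Rightarrow> nat \<Rightarrow> nat) \<Rightarrow> nat \<Rightarrow> nat \<Rightarrow> (nat \<Rightarrow> nat) \<Rightarrow> nat \<Rightarrow> nat" where
  "countdown i f u v R = foldr (\<lambda>w S. f (S(one := 1, i := w))) [u..<v] R"

lemma countdown_refl [simp]: "countdown i f v v R = R"
  by (simp add: countdown_def)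

lemma countdown_Suc_left:
  "u < v \<Longrightarrow> countdown i f u v R = f ((countdown i f (Suc u) v R)(one := 1, i := u))"
  by (simp add: countdown_def upt_conv_Cons)

lemma countdown_Suc_right:
  "u \<le> v \<Longrightarrow> countdown i f u (Suc v) R = countdown i f u v (f (R(one := 1, i := v)))"
  by (simp add: countdown_def)

primrec result :: "nat list \<Rightarrow> com \<Rightarrow> (nat \<Rightarrow> nat) \<Rightarrow> nat \<Rightarrow> nat" where
  "result x (Block is) R = fold (effect x) is R"
| result_Seq: "result x (c ;; d) R = result x d (result x c R)"
| "result x (When i c) R = (if R i = 0 then R else result x c R)"
| result_For: "result x (For i c) R = countdown i (result x c) 0 (R i) R"

primrec time :: "nat list \<Rightarrow> com \<Rightarrow> (nat \<Rightarrow> nat) \<Rightarrow> nat" where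
  "time x (Block is) R = length is"
| "time x (c ;; d) R = time x c R + time x d (result x c R)"
| "time x (When i c) R = (if R i = 0 then 1 else 1 + time x c R)"
| "time x (For i c) R =
     (\<Sum>v<R i. time x c ((countdown i (result x c) (Suc v) (R i) R)(one := 1, i := v)) + 4) + 1"

declare result_For [simp del]

fun target :: "instr \<Rightarrow> nat set" where
  "target (Const i c) = {i}"
| "target (Add i j l) = {i}"
| "target (Sub i j l) = {i}"
| "target (Half i j) = {i}"
| "target (Load i j) = {i}"
| "target (Store i j) = UNIV"
| "target (Read i j) = {i}"
| "target (Jump a) = {}"
| "target (JumpZero i a) = {}"

fun writes :: "com \<Rightarrow> nat set" where
  "writes (Block is) = \<Union>(target ` set is)"
| "writes (c ;; d) = writes c \<union> writes d"
| "writes (When i c) = writes c"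
| "writes (For i c) = {i, one} \<union> writes c"

lemma effect_frame: "r \<notin> target i \<Longrightarrow> effect x i R r = R r"
  by (cases i) auto

lemma countdown_frame:
  assumes "\<And>S. f S r = S r" "r \<noteq> i" "r \<noteq> one"
  shows "countdown i f u v R r = R r"
proof -
  have "foldr (\<lambda>w S. f (S(one := 1, i := w))) vs R r = R r" for vs
    using assms by (induction vs) auto
  then show ?thesis by (simp add: countdown_def)
qed

lemma result_frame [simp]: "r \<notin> writes c \<Longrightarrow> result x c R r = R r"
proof (induction c arbitrary: R)
  case (Block "is")
  then show ?case by (induction "is" arbitrary: R) (auto simp: effect_frame)
qed (auto simp: result_For intro: countdown_frame)

lemma result_For_induct:
  assumes start: "P (R i) R"
    and step: "\<And>v S. v < R i \<Longrightarrow> (\<And>r. r \<notin> writes (For i c) \<Longrightarrow> S r = R r) \<Longrightarrow> P (Suc v) S \<Longrightarrow>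
      P v (result x c (S(one := 1, i := v)))"
  shows "P 0 (result x (For i c) R)"
proof -
  let ?S = "\<lambda>v. countdown i (result x c) v (R i) R"
  have frame: "?S v r = R r" if "r \<notin> writes (For i c)" for v r
    using that by (intro countdown_frame) auto
  have "P v (?S v)" if "v \<le> R i" for v
    using that
  proof (induction rule: inc_induct)
    case base
    show ?case using start by simp
  next
    case (step v)
    then show ?case using assms(2)[of v "?S (Suc v)"] frame by (simp add: countdown_Suc_left)
  qed
  then show ?thesis by (simp add: result_For)
qed

fun no_jump :: "instr \<Rightarrow> bool" where
  "no_jump (Jump a) = False"
| "no_jump (JumpZero i a) = False"
| "no_jump _ = True"

primrec well_formed :: "com \<Rightarrow> bool" where
  "well_formed (Block is) \<longleftrightarrow> list_all no_jump is"
| "well_formed (c ;; d) \<longleftrightarrow> well_formed c \<and> well_formed d"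
| "well_formed (When i c) \<longleftrightarrow> well_formed c"
| "well_formed (For i c) \<longleftrightarrow> well_formed c \<and> i \<notin> insert one (writes c)"

lemma For_unfold:
  fixes x :: "nat list"
  assumes "well_formed (For i c)" "R i = Suc v"
  defines "S \<equiv> result x c (R(one := 1, i := v))"
  shows "S i = v" "result x (For i c) R = result x (For i c) S"
    "time x (For i c) R = 3 + (time x c (R(one := 1, i := v)) + (1 + time x (For i c) S))"
proof -
  show S: "S i = v" using assms(1) by (simp add: S_def)
  then show "result x (For i c) R = result x (For i c) S"
    using assms(2) by (simp add: result_For countdown_Suc_right S_def)
  show "time x (For i c) R = 3 + (time x c (R(one := 1, i := v)) + (1 + time x (For i c) S))"
    using S assms(2) by (simp add: countdown_Suc_right Suc_le_eq S_def)
qed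

lemma exec_no_jump: "no_jump i \<Longrightarrow> exec x i (pc, R) = (Suc pc, effect x i R)"
  by (cases i) (auto simp: effect_def)

lemma step_at: "step (pre @ i # post) x (length pre, R) = exec x i (length pre, R)"
  by (simp add: step_def)

lemma funpow_trans: "(f ^^ m) a = b \<Longrightarrow> (f ^^ n) b = c \<Longrightarrow> (f ^^ (m + n)) a = c"
  by (simp add: add.commute[of m n] funpow_add)

lemma steps_Block:
  assumes "list_all no_jump is"
  shows "(step (pre @ is @ post) x ^^ length is) (length pre, R) =
    (length pre + length is, fold (effect x) is R)"
  using assms
proof (induction "is" arbitrary: pre R)
  case (Cons i "is")
  have "step (pre @ (i # is) @ post) x (length pre, R) = (Suc (length pre), effect x i R)"
    using Cons.prems step_at[of pre i "is @ post"] exec_no_jump by simp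
  then show ?case
    using Cons.IH[of "pre @ [i]" "effect x i R"] Cons.prems
    by (simp add: funpow_swap1 del: funpow.simps add: funpow_Suc_right)
qed simp

lemma steps_For:
  assumes body: "\<And>pre post R.
      (step (pre @ compile (length pre) c @ post) x ^^ time x c R) (length pre, R) =
      (length pre + csize c, result x c R)"
    and wf: "well_formed (For i c)"
  shows "(step (pre @ compile (length pre) (For i c) @ post) x ^^ time x (For i c) R)
      (length pre, R) =
    (length pre + csize (For i c), result x (For i c) R)"
proof (induction "R i" arbitrary: R)
  case 0
  then show ?case using step_at by (simp add: result_For)
next
  case (Suc v)
  let ?P = "pre @ compile (length pre) (For i c) @ post" and ?a = "length pre"
  let ?enter = "[JumpZero i (?a + csize c + 4), Const one 1, Sub i i one]"
  let ?R = "R(one := 1, i := v)"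
  note unfold = For_unfold[where R = R and v = v, OF wf Suc.hyps(2)[symmetric]]
  have enter: "(step ?P x ^^ 3) (?a, R) = (?a + 3, ?R)"
    using Suc.hyps(2)[symmetric] wf by (simp add: step_def nth_append numeral_3_eq_3)
  have iterate: "(step ?P x ^^ time x c ?R) (?a + 3, ?R) = (?a + 3 + csize c, result x c ?R)"
    using body[where pre = "pre @ ?enter" and post = "Jump ?a # post" and R = ?R]
    by (simp add: numeral_3_eq_3)
  have repeat: "(step ?P x ^^ 1) (?a + 3 + csize c, result x c ?R) = (?a, result x c ?R)"
    using step_at[of "pre @ ?enter @ compile (?a + 3) c" "Jump ?a" post]
    by (simp add: numeral_3_eq_3)
  have rest: "(step ?P x ^^ time x (For i c) (result x c ?R)) (?a, result x c ?R) =
      (?a + csize (For i c), result x (For i c) (result x c ?R))"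
    by (rule Suc.hyps(1)) (simp only: unfold(1))
  show ?case
    unfolding unfold(2,3)
    by (rule funpow_trans[OF enter funpow_trans[OF iterate funpow_trans[OF repeat rest]]])
qed

theorem steps_compile:
  assumes "well_formed c"
  shows "(step (pre @ compile (length pre) c @ post) x ^^ time x c R) (length pre, R) =
    (length pre + csize c, result x c R)"
  using assms
proof (induction c arbitrary: pre post R)
  case (Block "is")
  then show ?case using steps_Block by simp
next
  case (Seq c d)
  let ?P = "pre @ compile (length pre) (c ;; d) @ post"
  have "(step ?P x ^^ time x c R) (length pre, R) = (length pre + csize c, result x c R)"
    using Seq.IH(1)[where pre = pre and post = "compile (length pre + csize c) d @ post"] Seq.prems
    by simp
  moreover have "(step ?P x ^^ time x d (result x c R)) (length pre + csize c, result x c R) =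
      (length pre + csize c + csize d, result x d (result x c R))"
    using Seq.IH(2)[where pre = "pre @ compile (length pre) c"] Seq.prems by simp
  ultimately show ?case using funpow_trans by (simp add: add.assoc)
next
  case (When i c)
  let ?P = "pre @ compile (length pre) (When i c) @ post"
  let ?skip = "JumpZero i (length pre + Suc (csize c))"
  show ?case
  proof (cases "R i = 0")
    case True
    then show ?thesis using step_at by simp
  next
    case False
    then have "(step ?P x ^^ 1) (length pre, R) = (length pre + 1, R)" using step_at by simp
    moreover have "(step ?P x ^^ time x c R) (length pre + 1, R) =
        (length pre + Suc (csize c), result x c R)"
      using When.IH[where pre = "pre @ [?skip]"] When.prems by simp
    ultimately have "(step ?P x ^^ (1 + time x c R)) (length pre, R) =
        (length pre + Suc (csize c), result x c R)"
      by (rule funpow_trans)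
    then show ?thesis using False by simp
  qed
next
  case (For i c)
  then show ?case by (intro steps_For) auto
qed

theorem outputs_within_compile:
  assumes "well_formed c" "time x c (\<lambda>_. 0) \<le> t"
  shows "outputs_within (compile 0 c) x (result x c (\<lambda>_. 0) 0) t"
proof -
  let ?R = "result x c (\<lambda>_. 0)"
  have run: "(step (compile 0 c) x ^^ time x c (\<lambda>_. 0)) (0, \<lambda>_. 0) = (csize c, ?R)"
    using steps_compile[OF assms(1), where pre = "[]" and post = "[]"] by simp
  have halted: "(step (compile 0 c) x ^^ s) (csize c, ?R) = (csize c, ?R)" for s
    by (induction s) (auto simp: step_def)
  show ?thesis
    using funpow_trans[OF run halted, of "t - time x c (\<lambda>_. 0)"] assms(2)
    by (auto simp: outputs_within_def)
qed

primrec loops_le :: "nat \<Rightarrow> nat list \<Rightarrow> com \<Rightarrow> (nat \<Rightarrow> nat) \<Rightarrow> bool" where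
  "loops_le z x (Block is) R \<longleftrightarrow> length is \<le> z"
| "loops_le z x (c ;; d) R \<longleftrightarrow> loops_le z x c R \<and> loops_le z x d (result x c R)"
| "loops_le z x (When i c) R \<longleftrightarrow> (R i \<noteq> 0 \<longrightarrow> loops_le z x c R)"
| loops_le_For: "loops_le z x (For i c) R \<longleftrightarrow> R i \<le> z \<and>
     (\<forall>v<R i. loops_le z x c ((countdown i (result x c) (Suc v) (R i) R)(one := 1, i := v)))"

declare loops_le_For [simp del]

lemma loops_le_ForI:
  assumes "R i \<le> z"
    and "\<And>v S. v < R i \<Longrightarrow> (\<And>r. r \<notin> writes (For i c) \<Longrightarrow> S r = R r) \<Longrightarrow>
      loops_le z x c (S(one := 1, i := v))"
  shows "loops_le z x (For i c) R"
proof -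
  have "countdown i (result x c) (Suc v) (R i) R r = R r" if "r \<notin> writes (For i c)" for v r
    using that by (intro countdown_frame) auto
  then show ?thesis using assms by (simp add: loops_le_For)
qed

primrec depth :: "com \<Rightarrow> nat" where
  "depth (Block is) = 1"
| "depth (c ;; d) = Suc (max (depth c) (depth d))"
| "depth (When i c) = Suc (depth c)"
| "depth (For i c) = depth c + 2"

theorem time_le_power_depth:
  assumes "loops_le z x c R" "6 \<le> z"
  shows "time x c R \<le> z ^ depth c"
  using assms(1)
proof (induction c arbitrary: R)
  case (Block "is")
  then show ?case by simp
next
  case (Seq c d)
  let ?m = "max (depth c) (depth d)"
  have "time x c R \<le> z ^ ?m" "time x d (result x c R) \<le> z ^ ?m"
    using Seq assms(2) power_increasing[of "depth c" ?m z] power_increasing[of "depth d" ?m z]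
    by (force intro: order_trans)+
  moreover have "2 * z ^ ?m \<le> z * z ^ ?m" using assms(2) by (intro mult_le_mono1) simp
  ultimately show ?case unfolding time.simps depth.simps power_Suc by linarith
next
  case (When i c)
  have "1 \<le> z ^ depth c" using assms(2) by simp
  moreover have "time x (When i c) R \<le> 1 + z ^ depth c" using When by simp
  moreover have "2 * z ^ depth c \<le> z * z ^ depth c" using assms(2) by (intro mult_le_mono1) simp
  ultimately show ?case unfolding depth.simps power_Suc by linarith
next
  case (For i c)
  let ?p = "z ^ depth c"
  have "1 \<le> ?p" using assms(2) by simp
  have "time x (For i c) R \<le> (\<Sum>v<R i. ?p + 4) + 1"
    unfolding time.simps using For by (intro add_mono sum_mono) (auto simp: loops_le_For)
  also have "\<dots> = R i * (?p + 4) + 1" by simp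
  also have "\<dots> \<le> z * (5 * ?p) + z * ?p"
    using For.prems assms(2) \<open>1 \<le> ?p\<close>
    by (intro add_mono mult_le_mono) (auto simp: loops_le_For)
  also have "\<dots> = 6 * (z * ?p)" by simp
  also have "\<dots> \<le> z * (z * ?p)" using assms(2) by (intro mult_le_mono1)
  also have "\<dots> = z ^ depth (For i c)" by simp
  finally show ?case .
qed

section \<open>Guessed sequences of pairs\<close>

text \<open>A block of \<open>card A\<close> bits of a guess \<open>g\<close> selects the least element of \<open>A\<close> whose bit is set.
  The bits are assigned to \<open>A\<close> in descending order, as the loops of the machine count down.\<close>

definition rank :: "nat set \<Rightarrow> nat \<Rightarrow> nat" where
  "rank A v = card {u \<in> A. v < u}"

definition pick_from :: "nat set \<Rightarrow> nat \<Rightarrow> nat \<Rightarrow> nat" where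
  "pick_from A v g = (let C = {u \<in> A. v \<le> u \<and> bit g (rank A u)} in if C = {} then 0 else Min C)"

fun guessed_pairs :: "nat set \<Rightarrow> nat \<Rightarrow> nat \<Rightarrow> (nat \<times> nat) list" where
  "guessed_pairs A 0 g = []"
| "guessed_pairs A (Suc j) g =
     (pick_from A 0 g, pick_from A 0 (g div 2 ^ card A)) #
       guessed_pairs A j (g div 2 ^ card A div 2 ^ card A)"

lemma length_guessed_pairs [simp]: "length (guessed_pairs A j g) = j"
  by (induction A j g rule: guessed_pairs.induct) auto

lemma rank_less_card: "finite A \<Longrightarrow> v \<in> A \<Longrightarrow> rank A v < card A"
  unfolding rank_def by (rule psubset_card_mono) auto

lemma inj_on_rank:
  assumes "finite A"
  shows "inj_on (rank A) A"
proof (rule linorder_inj_onI)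
  fix u v assume "u < v" "v \<in> A"
  then have "{w \<in> A. v < w} \<subset> {w \<in> A. u < w}" by auto
  then have "rank A v < rank A u"
    unfolding rank_def using assms by (intro psubset_card_mono) auto
  then show "rank A u \<noteq> rank A v" by simp
qed auto

lemma pick_from_unfold:
  assumes "finite A"
  shows "pick_from A v g = (if v \<in> A \<and> bit g (rank A v) then v else pick_from A (Suc v) g)"
proof -
  let ?C = "\<lambda>v. {u \<in> A. v \<le> u \<and> bit g (rank A u)}"
  show ?thesis
  proof (cases "v \<in> A \<and> bit g (rank A v)")
    case True
    then have "?C v \<noteq> {}" by auto
    moreover have "Min (?C v) = v" using assms True by (intro Min_eqI) auto
    ultimately show ?thesis unfolding pick_from_def Let_def using True by presburger
  next
    case False
    then have "?C v = ?C (Suc v)" by (auto simp: Suc_le_eq le_less)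
    then show ?thesis unfolding pick_from_def using False by presburger
  qed
qed

lemma pick_from_le:
  assumes "finite A" "A \<subseteq> {..m}"
  shows "pick_from A v g \<le> m"
proof -
  let ?C = "{u \<in> A. v \<le> u \<and> bit g (rank A u)}"
  have "Min ?C \<in> ?C" if "?C \<noteq> {}" using assms(1) that by (intro Min_in) auto
  then show ?thesis using assms(2) unfolding pick_from_def Let_def by (auto split: if_splits)
qed

lemma pick_from_block:
  fixes g :: nat
  assumes A: "finite A" "v \<in> A"
  defines "h \<equiv> 2 ^ rank A v + 2 ^ card A * g"
  shows "pick_from A 0 h = v" "h div 2 ^ card A = g"
    and "g < 2 ^ m \<Longrightarrow> h < 2 ^ (card A + m)"
proof -
  have less: "(2::nat) ^ rank A v < 2 ^ card A" using rank_less_card[OF A] by simp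
  have "bit h (rank A u) \<longleftrightarrow> u = v" if "u \<in> A" for u
  proof -
    have "take_bit (card A) h = 2 ^ rank A v" using less by (simp add: h_def take_bit_eq_mod)
    moreover have "bit h (rank A u) \<longleftrightarrow> bit (take_bit (card A) h) (rank A u)"
      using rank_less_card[OF A(1) that] by (simp add: bit_take_bit_iff)
    ultimately show ?thesis
      using inj_on_rank[OF A(1)] A(2) that by (auto simp: bit_exp_iff inj_on_def)
  qed
  then have "{u \<in> A. 0 \<le> u \<and> bit h (rank A u)} = {v}" using A(2) by auto
  then show "pick_from A 0 h = v" by (simp add: pick_from_def)
  show "h div 2 ^ card A = g" using less by (simp add: h_def)
  assume "g < 2 ^ m"
  then have "2 ^ card A * (Suc g) \<le> 2 ^ card A * 2 ^ m" by (intro mult_le_mono2) simp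
  then show "h < 2 ^ (card A + m)" unfolding h_def power_add mult_Suc_right using less by linarith
qed

lemma ex_guessed_pairs:
  assumes "finite A" "set ps \<subseteq> A \<times> A"
  shows "\<exists>g < 2 ^ (2 * length ps * card A). guessed_pairs A (length ps) g = ps"
  using assms(2)
proof (induction ps)
  case (Cons e ps)
  then obtain a b g where e: "e = (a, b)" "a \<in> A" "b \<in> A"
    and g: "g < 2 ^ (2 * length ps * card A)" "guessed_pairs A (length ps) g = ps"
    by (cases e) auto
  let ?h = "2 ^ rank A b + 2 ^ card A * g"
  let ?i = "2 ^ rank A a + 2 ^ card A * ?h"
  note b = pick_from_block[OF assms(1) e(3), of g] and a = pick_from_block[OF assms(1) e(2), of ?h]
  have "?i < 2 ^ (card A + (card A + 2 * length ps * card A))" by (intro a(3) b(3) g(1))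
  then have "?i < 2 ^ (2 * length (e # ps) * card A)" by (simp add: algebra_simps)
  moreover have "guessed_pairs A (length (e # ps)) ?i = e # ps"
    using a(1,2) b(1,2) g(2) e(1) by simp
  ultimately show ?case by blast
qed simp

lemma card_ge:
  assumes "finite A"
  shows "card {u \<in> A. v \<le> u} = (if v \<in> A then Suc (rank A v) else rank A v)"
proof -
  have "{u \<in> A. v \<le> u} = (if v \<in> A then insert v {u \<in> A. v < u} else {u \<in> A. v < u})"
    by (auto simp: le_less)
  then show ?thesis using assms by (simp add: rank_def)
qed

lemma card_ge_Suc: "card {u \<in> A. Suc v \<le> u} = rank A v"
  by (simp add: rank_def Suc_le_eq)

section \<open>The search program\<close>

abbreviation (input) answer :: nat where "answer \<equiv> 0"
abbreviation (input) order :: nat where "order \<equiv> 2"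
abbreviation (input) param :: nat where "param \<equiv> 3"
abbreviation (input) edge :: nat where "edge \<equiv> 4"
abbreviation (input) cnt :: nat where "cnt \<equiv> 5"
abbreviation (input) edge' :: nat where "edge' \<equiv> 6"
abbreviation (input) col :: nat where "col \<equiv> 7"
abbreviation (input) same :: nat where "same \<equiv> 8"
abbreviation (input) tmp :: nat where "tmp \<equiv> 9"
abbreviation (input) tmp' :: nat where "tmp' \<equiv> 10"
abbreviation (input) smaller :: nat where "smaller \<equiv> 11"
abbreviation (input) cand :: nat where "cand \<equiv> 12"
abbreviation (input) is_rep :: nat where "is_rep \<equiv> 13"
abbreviation (input) width :: nat where "width \<equiv> 14"
abbreviation (input) vert :: nat where "vert \<equiv> 15"
abbreviation (input) tail :: nat where "tail \<equiv> 16"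
abbreviation (input) later :: nat where "later \<equiv> 17"
abbreviation (input) crossing :: nat where "crossing \<equiv> 18"
abbreviation (input) end\<^sub>1 :: nat where "end\<^sub>1 \<equiv> 19"
abbreviation (input) end\<^sub>2 :: nat where "end\<^sub>2 \<equiv> 20"
abbreviation (input) rest :: nat where "rest \<equiv> 21"
abbreviation (input) ok :: nat where "ok \<equiv> 22"
abbreviation (input) pairs_left :: nat where "pairs_left \<equiv> 23"
abbreviation (input) guess :: nat where "guess \<equiv> 24"
abbreviation (input) exp\<^sub>0 :: nat where "exp\<^sub>0 \<equiv> 25"
abbreviation (input) exp\<^sub>1 :: nat where "exp\<^sub>1 \<equiv> 26"
abbreviation (input) bits :: nat where "bits \<equiv> 27"

abbreviation copy :: "nat \<Rightarrow> nat \<Rightarrow> instr list" where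
  "copy d s \<equiv> [Const d 0, Add d s d]"

definition adj_com :: "nat \<Rightarrow> nat \<Rightarrow> com" where
  "adj_com a b = Block (Const edge 2 # copy cnt a) ;; For cnt (Block [Add edge edge order]) ;;
     Block [Add edge edge b, Read edge edge]"

definition twin_com :: com where
  "twin_com = Block (Const same 1 # copy col order) ;;
     For col (adj_com smaller col ;; Block (copy edge' edge) ;; adj_com cand col ;;
       Block [Sub tmp edge edge', Sub tmp' edge' edge, Add tmp tmp tmp'] ;;
       When tmp (Block [Const same 0]))"

definition rep_com :: com where
  "rep_com = Block (Const is_rep 1 # copy smaller cand) ;;
     For smaller (twin_com ;; When same (Block [Const is_rep 0]))"

definition width_com :: com where
  "width_com = Block (Const width 0 # copy cand order) ;;
     For cand (rep_com ;; When is_rep (Block [Add width width param, Add width width param]))"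

definition pick_com :: "nat \<Rightarrow> nat \<Rightarrow> com" where
  "pick_com s d = Block (Const d 0 # copy cand order) ;;
     For cand (rep_com ;; When is_rep (
       Block ([Half tmp s, Add tmp' tmp tmp, Sub tmp' s tmp'] @ copy s tmp) ;;
       When tmp' (Block (copy d cand))))"

definition visit_com :: com where
  "visit_com = pick_com tail vert ;; adj_com end\<^sub>1 vert ;; Block [Add crossing crossing edge] ;;
     adj_com end\<^sub>2 vert ;; Block [Add crossing crossing edge]"

definition cross_com :: com where
  "cross_com = Block (Const crossing 0 # copy tail rest @ copy later pairs_left) ;;
     For later (visit_com ;; visit_com)"

definition check_com :: "nat \<Rightarrow> com" where
  "check_com r = pick_com rest end\<^sub>1 ;; pick_com rest end\<^sub>2 ;; adj_com end\<^sub>1 end\<^sub>2 ;;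
     Block [Const tmp 1, Sub tmp tmp edge] ;; When tmp (Block [Const ok 0]) ;;
     cross_com ;; Block [Const tmp r, Sub tmp crossing tmp] ;; When tmp (Block [Const ok 0])"

definition guess_com :: "nat \<Rightarrow> com" where
  "guess_com r = Block (Const ok 1 # copy rest guess @ copy pairs_left param) ;;
     For pairs_left (check_com r) ;; When ok (Block [Const answer 1])"

definition search_com :: "nat \<Rightarrow> com" where
  "search_com r = For guess (guess_com r)"

definition exp_com :: "nat \<Rightarrow> nat \<Rightarrow> com" where
  "exp_com d s = Block (Const d 1 # copy cnt s) ;; For cnt (Block [Add d d d])"

definition tower_com :: "nat \<Rightarrow> com" where
  "tower_com e = Block (Const exp\<^sub>0 0 # replicate e (Add exp\<^sub>0 exp\<^sub>0 param)) ;;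
     exp_com exp\<^sub>1 exp\<^sub>0 ;; exp_com bits exp\<^sub>1 ;; exp_com guess bits"

definition main_com :: "nat \<Rightarrow> nat \<Rightarrow> com" where
  "main_com e r = Block [Read order answer, Const param 1, Read param param] ;;
     width_com ;; tower_com e ;; search_com r ;;
     Block [Sub tmp width bits] ;; When tmp (Block [Const answer 1])"

lemma writes_adj_com [simp]: "writes (adj_com a b) = {one, edge, cnt}"
  by (auto simp: adj_com_def)

lemma writes_twin_com [simp]: "writes twin_com = {one, edge, cnt, edge', col, same, tmp, tmp'}"
  by (auto simp: twin_com_def)

lemma writes_rep_com [simp]: "writes rep_com = insert smaller (insert is_rep (writes twin_com))"
  by (auto simp: rep_com_def)

lemma writes_width_com [simp]: "writes width_com = insert cand (insert width (writes rep_com))"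
  by (auto simp: width_com_def)

lemma writes_pick_com [simp]: "writes (pick_com s d) = {s, d, cand} \<union> writes rep_com"
  by (auto simp: pick_com_def)

lemma writes_visit_com [simp]: "writes visit_com = {tail, vert, cand, crossing} \<union> writes rep_com"
  by (auto simp: visit_com_def)

lemma writes_cross_com [simp]: "writes cross_com = insert later (writes visit_com)"
  by (auto simp: cross_com_def)

lemma writes_check_com [simp]: "writes (check_com r) = {rest, end\<^sub>1, end\<^sub>2, ok} \<union> writes cross_com"
  by (auto simp: check_com_def)

lemma writes_guess_com [simp]: "writes (guess_com r) = {answer, pairs_left} \<union> writes (check_com r)"
  by (auto simp: guess_com_def)

lemma writes_search_com [simp]: "writes (search_com r) = insert guess (writes (guess_com r))"
  by (auto simp: search_com_def)

lemma writes_exp_com [simp]: "writes (exp_com d s) = {one, cnt, d}"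
  by (auto simp: exp_com_def)

lemma writes_tower_com [simp]: "writes (tower_com e) = {one, cnt, exp\<^sub>0, exp\<^sub>1, bits, guess}"
  by (auto simp: tower_com_def)

lemma well_formed_main_com: "well_formed (main_com e r)"
  by (simp add: main_com_def width_com_def rep_com_def twin_com_def adj_com_def tower_com_def
      exp_com_def search_com_def guess_com_def check_com_def cross_com_def visit_com_def
      pick_com_def list_all_iff)

section \<open>Correctness\<close>

lemma result_exp_com:
  assumes "d \<notin> {one, cnt, s}" "s \<notin> {one, cnt}"
  shows "result x (exp_com d s) R d = 2 ^ R s"
proof -
  have "result x (exp_com d s) R d * 2 ^ 0 = 2 ^ R s"
    unfolding exp_com_def result_Seq
    by (rule result_For_induct[where P = "\<lambda>v S. S d * 2 ^ v = 2 ^ R s"])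
      (use assms in \<open>auto simp: algebra_simps\<close>)
  then show ?thesis by simp
qed

lemma funpow_effect_Add [simp]:
  "d \<noteq> s \<Longrightarrow> (effect x (Add d d s) ^^ e) R = R(d := R d + e * R s)"
  by (induction e) auto

lemma result_tower_com:
  shows "result x (tower_com e) R bits = 2 ^ 2 ^ (e * R param)"
    and "result x (tower_com e) R guess = 2 ^ 2 ^ 2 ^ (e * R param)"
  by (simp_all add: tower_com_def result_exp_com)

locale encoded_graph =
  fixes G :: "nat sgraph" and n k :: nat and x :: "nat list"
  assumes simple: "simple_graph G" and verts: "verts G = {..<n}" and x: "x = encode (G, k)"
begin

lemma x_eq: "x = n # k # map (\<lambda>(i, j). adj G i j) (List.product [0..<n] [0..<n])"
  using verts
  by (simp add: x encode_def Let_def product_concat_map map_concat comp_def adj_def of_bool_def)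

lemma input_at_encode: "input_at x 0 = n" "input_at x (Suc 0) = k"
  by (simp_all add: x_eq input_at_def)

text \<open>Truncated subtraction covers the case \<open>n = 0\<close>, in which the machine still uses vertex 0.\<close>

lemma input_at_adj:
  assumes "u \<le> n - 1" "v \<le> n - 1"
  shows "input_at x (2 + u * n + v) = adj G u v"
proof (cases "n = 0")
  case True
  then have "{0, 0} \<notin> edges G" using simple_graph_edgeD(2)[OF simple, of 0 0] verts by auto
  then show ?thesis using assms True by (simp add: x_eq input_at_def)
next
  case False
  then have uv: "u < n" "v < n" using assms by linarith+
  then have "u * n + v < Suc u * n" by simp
  also have "\<dots> \<le> n * n" using uv by (intro mult_le_mono1) simp
  finally have "u * n + v < n * n" .
  then show ?thesis using uv by (simp add: x_eq input_at_def product_nth)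
qed

lemma result_adj_com:
  assumes "a \<notin> {one, edge, cnt}" "b \<notin> {one, edge, cnt}"
    and "R order = n" "R a \<le> n - 1" "R b \<le> n - 1"
  shows "result x (adj_com a b) R edge = adj G (R a) (R b)"
proof -
  let ?R = "R(edge := 2, cnt := R a)"
  have "result x (For cnt (Block [Add edge edge order])) ?R edge + 0 * n = 2 + R a * n"
    by (rule result_For_induct[where P = "\<lambda>v S. S edge + v * n = 2 + R a * n"]) (use assms in auto)
  then show ?thesis using assms input_at_adj[of "R a" "R b"] by (simp add: adj_com_def)
qed

lemma nbrs_eq_iff_adj: "nbrs G u = nbrs G v \<longleftrightarrow> (\<forall>w\<in>{0..<n}. adj G u w = adj G v w)"
proof -
  have "w < n" if "{u, w} \<in> edges G" for u w
    using simple_graph_edgeD(3)[OF simple that] verts by simp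
  then show ?thesis by (auto simp: nbrs_def adj_def set_eq_iff)
qed

lemma result_twin_com:
  assumes "R order = n" "R smaller < n" "R cand < n"
  shows "result x twin_com R same = of_bool (nbrs G (R smaller) = nbrs G (R cand))"
proof -
  let ?agree = "\<lambda>v. of_bool (\<forall>w\<in>{v..<n}. adj G (R smaller) w = adj G (R cand) w)"
  have "result x twin_com R same = ?agree 0"
    unfolding twin_com_def result_Seq
  proof (rule result_For_induct[where P = "\<lambda>v S. S same = ?agree v"], goal_cases start step)
    case (step v S)
    then have "{v..<n} = insert v {Suc v..<n}" using assms by auto
    with step assms show ?case by (auto simp: result_adj_com)
  qed (use assms in simp)
  then show ?thesis by (simp add: nbrs_eq_iff_adj)
qed

lemma result_rep_com:
  assumes "R order = n" "R cand < n"
  shows "result x rep_com R is_rep = of_bool (R cand \<in> twin_reps G)"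
proof -
  let ?new = "\<lambda>v. of_bool (\<forall>u\<in>{v..<R cand}. nbrs G u \<noteq> nbrs G (R cand))"
  have "result x rep_com R is_rep = ?new 0"
    unfolding rep_com_def result_Seq
  proof (rule result_For_induct[where P = "\<lambda>v S. S is_rep = ?new v"], goal_cases start step)
    case (step v S)
    then have "{v..<R cand} = insert v {Suc v..<R cand}" by auto
    with step assms show ?case by (auto simp: result_twin_com)
  qed simp
  moreover have "R cand \<in> twin_reps G \<longleftrightarrow> (\<forall>u\<in>{0..<R cand}. nbrs G u \<noteq> nbrs G (R cand))"
    using assms(2) verts by (auto simp: twin_reps_def)
  ultimately show ?thesis by simp
qed

lemma twin_reps_less: "v \<in> twin_reps G \<Longrightarrow> v < n"
  using twin_reps_subset verts by blast

lemma finite_twin_reps: "finite (twin_reps G)"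
  using twin_reps_less by (meson bounded_nat_set_is_finite)

lemma card_twin_reps_ge_order: "card {v \<in> twin_reps G. n \<le> v} = 0"
  using twin_reps_less by (auto simp: not_le card_eq_0_iff)

lemma result_width_com:
  assumes "R order = n" "R param = k"
  shows "result x width_com R width = 2 * k * card (twin_reps G)"
proof -
  let ?w = "\<lambda>v. 2 * k * card {u \<in> twin_reps G. v \<le> u}"
  have "result x width_com R width = ?w 0"
    unfolding width_com_def result_Seq
  proof (rule result_For_induct[where P = "\<lambda>v S. S width = ?w v"], goal_cases start step)
    case start
    show ?case using assms card_twin_reps_ge_order by simp
  next
    case (step v S)
    with assms show ?case
      by (auto simp: result_rep_com card_ge[OF finite_twin_reps, of v] card_ge_Suc)
  qed
  then show ?thesis by simp
qed

lemma result_pick_com: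
  assumes "R order = n" "{s, d} \<inter> writes rep_com = {}" "{s, d} \<inter> {order, cand} = {}" "s \<noteq> d"
  shows "result x (pick_com s d) R d = pick_from (twin_reps G) 0 (R s)" (is ?picked)
    and "result x (pick_com s d) R s = R s div 2 ^ card (twin_reps G)" (is ?rest)
proof -
  let ?A = "twin_reps G" and ?g = "R s"
  let ?P = "\<lambda>v S. S d = pick_from ?A v ?g \<and> S s = ?g div 2 ^ card {u \<in> ?A. v \<le> u}"
  have "?P 0 (result x (pick_com s d) R)"
    unfolding pick_com_def result_Seq
  proof (rule result_For_induct[where P = ?P], goal_cases start step)
    case start
    have "pick_from ?A n ?g = 0" by (auto simp: pick_from_def dest: twin_reps_less)
    then show ?case using assms card_twin_reps_ge_order by auto
  next
    case (step v S)
    have "q - (q div 2 + q div 2) = q mod 2" for q :: nat by presburger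
    moreover have "q div 2 ^ i div 2 = q div (2 * 2 ^ i)" for q i :: nat
      by (metis div_mult2_eq mult.commute)
    ultimately show ?case using step assms
      by (auto simp: result_rep_com pick_from_unfold[OF finite_twin_reps, of v]
          card_ge[OF finite_twin_reps, of v] card_ge_Suc bit_iff_odd)
  qed
  then show ?picked ?rest by simp_all
qed

lemma pick_from_twin_reps_le: "pick_from (twin_reps G) 0 g \<le> n - 1"
  using twin_reps_less by (intro pick_from_le finite_twin_reps) fastforce

lemma result_visit_com:
  assumes "R order = n" "R end\<^sub>1 \<le> n - 1" "R end\<^sub>2 \<le> n - 1"
  defines "v \<equiv> pick_from (twin_reps G) 0 (R tail)"
  shows "result x visit_com R crossing = R crossing + adj G (R end\<^sub>1) v + adj G (R end\<^sub>2) v"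
    and "result x visit_com R tail = R tail div 2 ^ card (twin_reps G)"
  using assms pick_from_twin_reps_le by (simp_all add: visit_com_def result_pick_com result_adj_com)

lemma result_cross_com:
  assumes "R order = n" "R end\<^sub>1 \<le> n - 1" "R end\<^sub>2 \<le> n - 1"
  shows "result x cross_com R crossing =
    cross_edges G (R end\<^sub>1) (R end\<^sub>2) (guessed_pairs (twin_reps G) (R pairs_left) (R rest))"
proof -
  let ?cross = "\<lambda>j g. cross_edges G (R end\<^sub>1) (R end\<^sub>2) (guessed_pairs (twin_reps G) j g)"
  let ?P = "\<lambda>j S. S crossing + ?cross j (S tail) = ?cross (R pairs_left) (R rest)"
  have "?P 0 (result x cross_com R)"
    unfolding cross_com_def result_Seq
  proof (rule result_For_induct[where P = ?P], goal_cases start step)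
    case (step j S)
    with assms show ?case by (simp add: result_visit_com)
  qed simp
  then show ?thesis by simp
qed

lemma result_check_com:
  assumes "R order = n"
  defines "l \<equiv> card (twin_reps G)"
  defines "a \<equiv> pick_from (twin_reps G) 0 (R rest)"
    and "b \<equiv> pick_from (twin_reps G) 0 (R rest div 2 ^ l)"
    and "g \<equiv> R rest div 2 ^ l div 2 ^ l"
  shows "result x (check_com r) R rest = g"
    and "result x (check_com r) R ok =
      (if {a, b} \<in> edges G \<and> cross_edges G a b (guessed_pairs (twin_reps G) (R pairs_left) g) \<le> r
       then R ok else 0)"
  using assms pick_from_twin_reps_le
  by (simp_all add: check_com_def result_pick_com result_adj_com result_cross_com adj_def)

lemma result_guess_com:
  assumes "R order = n" "R param = k"
  shows "result x (guess_com r) R answer =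
    (if degenerate_matching G r (guessed_pairs (twin_reps G) k (R guess)) then 1 else R answer)"
proof -
  let ?good = "\<lambda>j g. degenerate_matching G r (guessed_pairs (twin_reps G) j g)"
  let ?P = "\<lambda>j S. S ok \<noteq> 0 \<and> ?good j (S rest) \<longleftrightarrow> ?good k (R guess)"
  let ?c = "For pairs_left (check_com r)"
  let ?R = "result x (Block (Const ok 1 # copy rest guess @ copy pairs_left param)) R"
  have "?P 0 (result x ?c ?R)"
  proof (rule result_For_induct[where P = ?P], goal_cases start step)
    case (step j S)
    with assms show ?case by (auto simp: result_check_com)
  qed (use assms in simp)
  then show ?thesis by (auto simp: guess_com_def)
qed

lemma result_search_com:
  assumes "R order = n" "R param = k" "R answer = 0"
  shows "result x (search_com r) R answer =
    of_bool (\<exists>g<R guess. degenerate_matching G r (guessed_pairs (twin_reps G) k g))"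
proof -
  let ?good = "\<lambda>g. degenerate_matching G r (guessed_pairs (twin_reps G) k g)"
  let ?found = "\<lambda>m. of_bool (\<exists>g\<in>{m..<R guess}. ?good g)"
  have "result x (search_com r) R answer = ?found 0"
    unfolding search_com_def
  proof (rule result_For_induct[where P = "\<lambda>m S. S answer = ?found m"], goal_cases start step)
    case (step m S)
    then have "{m..<R guess} = insert m {Suc m..<R guess}" by auto
    with step assms show ?case by (auto simp: result_guess_com)
  qed (use assms in simp)
  then show ?thesis by auto
qed

lemma result_main_com:
  "result x (main_com e r) (\<lambda>_. 0) answer = of_bool (2 ^ 2 ^ (e * k) < 2 * k * card (twin_reps G) \<or>
     (\<exists>g<2 ^ 2 ^ 2 ^ (e * k). degenerate_matching G r (guessed_pairs (twin_reps G) k g)))"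
  by (simp add: main_com_def result_search_com result_tower_com result_width_com input_at_encode)

end

section \<open>Running time\<close>

lemma loops_le_adj_com:
  assumes "a \<notin> {edge, cnt}" "R a \<le> z" "6 \<le> z"
  shows "loops_le z x (adj_com a b) R"
  using assms by (auto simp: adj_com_def intro!: loops_le_ForI)

lemma loops_le_twin_com:
  assumes "R order \<le> z" "R smaller \<le> z" "R cand \<le> z" "6 \<le> z"
  shows "loops_le z x twin_com R"
  using assms by (auto simp: twin_com_def intro!: loops_le_ForI loops_le_adj_com)

lemma loops_le_rep_com:
  assumes "R order \<le> z" "R cand \<le> z" "6 \<le> z"
  shows "loops_le z x rep_com R"
  using assms by (auto simp: rep_com_def intro!: loops_le_ForI loops_le_twin_com)

lemma loops_le_width_com:
  assumes "R order \<le> z" "6 \<le> z"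
  shows "loops_le z x width_com R"
  using assms by (auto simp: width_com_def intro!: loops_le_ForI loops_le_rep_com)

lemma loops_le_pick_com:
  assumes "R order \<le> z" "6 \<le> z" "{s, d} \<inter> {order, cand} = {}"
  shows "loops_le z x (pick_com s d) R"
  using assms by (auto simp: pick_com_def intro!: loops_le_ForI loops_le_rep_com)

lemma loops_le_exp_com:
  assumes "d \<notin> {one, cnt, s}" "s \<noteq> cnt" "R s \<le> z" "6 \<le> z"
  shows "loops_le z x (exp_com d s) R"
  using assms by (auto simp: exp_com_def intro!: loops_le_ForI)

lemma loops_le_tower_com:
  assumes "Suc e \<le> z" "6 \<le> z" "2 ^ 2 ^ (e * R param) \<le> z"
  shows "loops_le z x (tower_com e) R"
proof -
  let ?u = "e * R param"
  have "?u \<le> 2 ^ ?u" "(2::nat) ^ ?u \<le> 2 ^ 2 ^ ?u" by (auto intro: less_imp_le)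
  then have "?u \<le> z" "2 ^ ?u \<le> z" using assms(3) by linarith+
  then show ?thesis
    using assms by (simp add: tower_com_def loops_le_exp_com result_exp_com)
qed

lemma tower_power_le:
  assumes "k > 0"
  shows "(2 ^ 2 ^ 2 ^ (e * k)) ^ p \<le> (2::nat) ^ 2 ^ 2 ^ ((e + p) * k)"
proof -
  define t :: nat where "t = 2 ^ (e * k)"
  have "p + t \<le> Suc p * t" by (simp add: t_def)
  also have "\<dots> \<le> 2 ^ p * t" by (intro mult_le_mono1 Suc_leI) simp
  also have "\<dots> = 2 ^ (e * k + p)" by (simp add: t_def power_add)
  also have "\<dots> \<le> 2 ^ ((e + p) * k)"
    using assms by (intro power_increasing) (auto simp: algebra_simps)
  finally have exponent: "p + t \<le> 2 ^ ((e + p) * k)" .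
  have "((2::nat) ^ 2 ^ t) ^ p = 2 ^ (p * 2 ^ t)" by (simp add: mult.commute flip: power_mult)
  also have "\<dots> \<le> 2 ^ (2 ^ p * 2 ^ t)"
    by (intro power_increasing mult_le_mono1) (auto intro: less_imp_le)
  also have "\<dots> = 2 ^ 2 ^ (p + t)" by (simp add: power_add)
  also have "\<dots> \<le> 2 ^ 2 ^ 2 ^ ((e + p) * k)" using exponent by (intro power_increasing) auto
  finally show ?thesis by (simp add: t_def)
qed

context encoded_graph
begin

context
  fixes z :: nat
  assumes z: "n \<le> z" "k \<le> z" "6 \<le> z"
begin

lemma loops_le_visit_com:
  assumes "R order = n" "R end\<^sub>1 \<le> n - 1" "R end\<^sub>2 \<le> n - 1"
  shows "loops_le z x visit_com R"
  using assms z by (auto simp: visit_com_def intro!: loops_le_adj_com loops_le_pick_com)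

lemma loops_le_cross_com:
  assumes "R order = n" "R end\<^sub>1 \<le> n - 1" "R end\<^sub>2 \<le> n - 1" "R pairs_left \<le> z"
  shows "loops_le z x cross_com R"
  using assms z by (auto simp: cross_com_def intro!: loops_le_ForI loops_le_visit_com)

lemma loops_le_check_com:
  assumes "R order = n" "R pairs_left \<le> z"
  shows "loops_le z x (check_com r) R"
  using assms z pick_from_twin_reps_le order_trans[OF pick_from_twin_reps_le, of z]
  by (auto simp: check_com_def result_pick_com
      intro!: loops_le_adj_com loops_le_pick_com loops_le_cross_com)

lemma loops_le_guess_com:
  assumes "R order = n" "R param = k"
  shows "loops_le z x (guess_com r) R"
  using assms z by (auto simp: guess_com_def intro!: loops_le_ForI loops_le_check_com)

lemma loops_le_main_com:
  assumes "Suc e \<le> z" "2 ^ 2 ^ 2 ^ (e * k) \<le> z"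
  shows "loops_le z x (main_com e r) (\<lambda>_. 0)"
proof -
  have "(2::nat) ^ 2 ^ (e * k) \<le> 2 ^ 2 ^ 2 ^ (e * k)" by (simp add: less_imp_le)
  then have "2 ^ 2 ^ (e * k) \<le> z" using assms(2) by linarith
  then show ?thesis
    using assms z
    by (auto simp: main_com_def search_com_def result_tower_com input_at_encode
        intro!: loops_le_width_com loops_le_tower_com loops_le_ForI loops_le_guess_com)
qed

end

lemma length_le_input_size: "length x \<le> input_size x"
proof -
  have "(\<Sum>a\<leftarrow>x. 1) \<le> input_size x" unfolding input_size_def by (intro sum_list_mono) simp
  then show ?thesis by (simp add: sum_list_triv)
qed

lemma time_main_com_le:
  fixes r :: nat
  assumes "e > 0" "k > 0"
  defines "p \<equiv> depth (main_com e r)"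
  shows "time x (main_com e r) (\<lambda>_. 0) \<le> 2 ^ 2 ^ 2 ^ ((e + p) * k) * input_size x ^ p"
proof -
  define N :: nat where "N = 2 ^ 2 ^ 2 ^ (e * k)"
  define z where "z = N * input_size x"
  have "n \<le> n * n" by (cases n) auto
  moreover have "length x = n * n + 2" by (simp add: x_eq)
  ultimately have "n \<le> input_size x" "1 \<le> input_size x" using length_le_input_size by linarith+
  moreover have "1 \<le> N" by (simp add: N_def)
  ultimately have "N * 1 \<le> z" "1 * n \<le> z" unfolding z_def by (simp, intro mult_le_mono)
  moreover have "6 \<le> N"
  proof -
    have "(2::nat) ^ 2 ^ 2 ^ 1 \<le> N"
      unfolding N_def using assms(1,2) by (intro power_increasing) auto
    then show ?thesis by simp
  qed
  moreover have "Suc e \<le> N" "k \<le> N"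
  proof -
    have "e * k < 2 ^ (e * k)" "(2::nat) ^ (e * k) < 2 ^ 2 ^ (e * k)" "2 ^ 2 ^ (e * k) < N"
      by (simp_all add: N_def)
    moreover have "e \<le> e * k" "k \<le> e * k" using assms(1,2) by auto
    ultimately show "Suc e \<le> N" "k \<le> N" by linarith+
  qed
  ultimately have "loops_le z x (main_com e r) (\<lambda>_. 0)"
    by (intro loops_le_main_com) (auto simp flip: N_def)
  then have "time x (main_com e r) (\<lambda>_. 0) \<le> z ^ p"
    unfolding p_def using \<open>6 \<le> N\<close> \<open>N * 1 \<le> z\<close> by (intro time_le_power_depth) auto
  also have "\<dots> = N ^ p * input_size x ^ p" unfolding z_def by (rule power_mult_distrib)
  also have "\<dots> \<le> 2 ^ 2 ^ 2 ^ ((e + p) * k) * input_size x ^ p"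
    unfolding N_def using tower_power_le[OF assms(2)] by (rule mult_le_mono1)
  finally show ?thesis .
qed

end

lemma computable_tower: "computable (\<lambda>k. 2 ^ 2 ^ 2 ^ (e * k))"
proof -
  let ?c = "Block [Read param answer] ;; tower_com e ;; Block [Add answer answer guess]"
  have "result [k] ?c (\<lambda>_. 0) 0 = 2 ^ 2 ^ 2 ^ (e * k)" for k
    by (simp add: result_tower_com input_at_def)
  moreover have "well_formed ?c" by (simp add: tower_com_def exp_com_def list_all_iff)
  ultimately show ?thesis unfolding computable_def using outputs_within_compile order_refl by metis
qed

section \<open>Fixed-parameter tractability\<close>

lemma guess_width_bound:
  assumes "k > 0" "h + 3 \<le> e"
  defines "m \<equiv> 2 ^ (h + k)"
  shows "2 * k * (2 * m + 2 ^ (2 * m)) \<le> (2::nat) ^ 2 ^ (e * k)"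
proof -
  have "h + k < m" by (simp add: m_def)
  then have m: "k \<le> m" "2 \<le> m" using assms(1) by linarith+
  have "2 * m \<le> 2 ^ (2 * m)" by (simp add: less_imp_le)
  then have "2 * k * (2 * m + 2 ^ (2 * m)) \<le> 2 * 2 ^ k * (2 ^ (2 * m) + 2 ^ (2 * m))"
    by (intro mult_le_mono add_mono) (auto simp: less_imp_le)
  also have "\<dots> = 2 ^ (2 + k + 2 * m)" by (simp add: power_add)
  also have "\<dots> \<le> 2 ^ (4 * m)" using m by (intro power_increasing) auto
  also have "4 * m = 2 ^ (h + k + 2)" by (simp add: m_def power_add)
  also have "(2::nat) ^ 2 ^ (h + k + 2) \<le> 2 ^ 2 ^ (e * k)"
  proof -
    have "h + k + 2 \<le> (h + 3) * k" using assms(1) by (cases k) auto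
    also have "\<dots> \<le> e * k" using assms(2) by (rule mult_le_mono1)
    finally show ?thesis by (intro power_increasing) auto
  qed
  finally show ?thesis .
qed

context encoded_graph
begin

lemma many_twin_reps_imp_degenerate_matching:
  assumes "k > 0" "h + 3 \<le> e"
    and large: "\<forall>M. matching G M \<and> 2 ^ (h + k) \<le> card M \<longrightarrow> (\<exists>N\<subseteq>M. card N = k \<and> separated G N)"
    and many: "2 ^ 2 ^ (e * k) < 2 * k * card (twin_reps G)"
  shows "\<exists>ps. degenerate_matching G r ps \<and> length ps = k"
proof (cases "\<exists>M. matching G M \<and> 2 ^ (h + k) \<le> card M")
  case True
  then obtain M N where N: "matching G M" "N \<subseteq> M" "card N = k" "separated G N"
    using large by blast
  then obtain ps where "degenerate_matching G 0 ps" "length ps = k"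
    using separated_imp_degenerate_matching[OF simple matching_subset] by metis
  then show ?thesis using degenerate_matching_mono by blast
next
  case False
  let ?m = "2 ^ (h + k) :: nat"
  have "card M \<le> ?m" if "matching G M" for M using False that by (meson linear)
  then have "card (twin_reps G) \<le> 2 * ?m + 2 ^ (2 * ?m)" by (rule card_twin_reps_le[OF simple])
  then have "2 * k * card (twin_reps G) \<le> 2 * k * (2 * ?m + 2 ^ (2 * ?m))" by (rule mult_le_mono2)
  then show ?thesis using guess_width_bound[OF assms(1,2)] many by linarith
qed

lemma degenerate_matching_imp_guess:
  assumes "degenerate_matching G r ps"
  shows "\<exists>g < 2 ^ (2 * length ps * card (twin_reps G)).
    degenerate_matching G r (guessed_pairs (twin_reps G) (length ps) g)"
proof -
  obtain f where f: "\<And>v. v \<in> verts G \<Longrightarrow> f v \<in> twin_reps G \<and> nbrs G (f v) = nbrs G v"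
    using ex_twin_rep by metis
  let ?qs = "map (map_prod f f) ps"
  have "{p, q} \<in> edges G" if "(p, q) \<in> set ps" for p q
    using degenerate_matching_subset_edges[OF assms] that by (auto simp: pair_edges_def)
  then have "p \<in> verts G \<and> q \<in> verts G" if "(p, q) \<in> set ps" for p q
    using simple_graph_edgeD(2,3)[OF simple] that by blast
  then have ps: "set ps \<subseteq> verts G \<times> verts G" by auto
  then have "set ?qs \<subseteq> twin_reps G \<times> twin_reps G" using f by auto
  moreover have "degenerate_matching G r ?qs"
    using f by (intro degenerate_matching_map_twins[OF _ assms ps]) simp
  ultimately show ?thesis using ex_guessed_pairs[OF finite_twin_reps, of ?qs] by auto
qed

lemma search_correct:
  assumes "k > 0" "h + 3 \<le> e"
    and "\<forall>M. matching G M \<and> 2 ^ (h + k) \<le> card M \<longrightarrow> (\<exists>N\<subseteq>M. card N = k \<and> separated G N)"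
  shows "2 ^ 2 ^ (e * k) < 2 * k * card (twin_reps G) \<or>
     (\<exists>g<2 ^ 2 ^ 2 ^ (e * k). degenerate_matching G r (guessed_pairs (twin_reps G) k g)) \<longleftrightarrow>
    (\<exists>ps. degenerate_matching G r ps \<and> length ps = k)" (is "?many \<or> ?found \<longleftrightarrow> ?yes")
proof
  assume "?many \<or> ?found"
  then show ?yes
  proof
    assume ?many
    then show ?yes by (rule many_twin_reps_imp_degenerate_matching[OF assms])
  next
    assume ?found
    then show ?yes using length_guessed_pairs by blast
  qed
next
  assume ?yes
  then obtain g where g: "g < 2 ^ (2 * k * card (twin_reps G))"
    "degenerate_matching G r (guessed_pairs (twin_reps G) k g)"
    using degenerate_matching_imp_guess by blast
  show "?many \<or> ?found"
  proof (cases ?many)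
    case False
    then have "(2::nat) ^ (2 * k * card (twin_reps G)) \<le> 2 ^ 2 ^ 2 ^ (e * k)"
      by (intro power_increasing) auto
    then show ?thesis using g less_le_trans by blast
  qed simp
qed

end

lemma degenerate_matching_problem_fpt:
  assumes "graph_class \<H>" "minor_closed \<H>" "proper_class \<H>"
    and yes: "\<And>G k. simple_graph G \<Longrightarrow>
      yes (G, k) \<longleftrightarrow> (\<exists>ps. degenerate_matching G r ps \<and> length ps = k)"
  shows "fixed_parameter_tractable (instances \<H>) encode parameter yes"
proof -
  obtain h where h: "excludes_clique \<H> h"
    using proper_minor_closed_excludes_clique[OF assms(2,3)] .
  define e where "e = h + 3"
  let ?c = "main_com e r"
  let ?f = "\<lambda>k. 2 ^ 2 ^ 2 ^ ((e + depth ?c) * k)"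
  have "outputs_within (compile 0 ?c) (encode I) (if yes I then 1 else 0)
      (?f (parameter I) * input_size (encode I) ^ depth ?c)" if I: "I \<in> instances \<H>" for I
  proof -
    obtain G k n where G: "I = (G, k)" "G \<in> \<H>" "verts G = {..<n}" and k: "k > 0"
      using I by (auto simp: instances_def)
    have simple: "simple_graph G" using G(2) assms(1) by (simp add: graph_class_def)
    interpret encoded_graph G n k "encode (G, k)"
      using simple G(3) by unfold_locales auto
    have "\<forall>M. matching G M \<and> 2 ^ (h + k) \<le> card M \<longrightarrow> (\<exists>N\<subseteq>M. card N = k \<and> separated G N)"
      using large_matching_imp_separated_subset[OF assms(1,2) h G(2)] by blast
    then have answer: "result (encode (G, k)) ?c (\<lambda>_. 0) 0 = of_bool (yes (G, k))"
      unfolding result_main_com yes[OF simple]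
      by (subst search_correct[OF k, of h]) (simp_all add: e_def)
    have "time (encode (G, k)) ?c (\<lambda>_. 0) \<le> ?f k * input_size (encode (G, k)) ^ depth ?c"
      using k by (intro time_main_com_le) (simp_all add: e_def)
    from outputs_within_compile[OF well_formed_main_com this] show ?thesis
      unfolding G(1) parameter_def answer by (simp add: of_bool_def)
  qed
  then show ?thesis
    unfolding fixed_parameter_tractable_def using computable_tower[of "e + depth ?c"] by blast
qed

theorem theorem9:
  fixes \<H> :: "nat sgraph set"
  assumes "graph_class \<H>"
    and "minor_closed \<H>"
    and "proper_class \<H>"
  shows "fixed_parameter_tractable (instances \<H>) encode parameter acyclic_matching_problem \<and>
    fixed_parameter_tractable (instances \<H>) encode parameter induced_matching_problem"
proof
  show "fixed_parameter_tractable (instances \<H>) encode parameter acyclic_matching_problem"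
    using ex_acyclic_matching_iff_degenerate
    by (intro degenerate_matching_problem_fpt[OF assms, where r = 1])
      (simp add: acyclic_matching_problem_def)
  show "fixed_parameter_tractable (instances \<H>) encode parameter induced_matching_problem"
    using ex_induced_matching_iff_degenerate
    by (intro degenerate_matching_problem_fpt[OF assms, where r = 0])
      (simp add: induced_matching_problem_def)
qed

end
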